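(* Let $d\ge 4$ be an even integer and let $n$ be an integer with $$n>\bigl(c_{d-1}(d+1)\bigr)^{d-1}\,(3d/2-1).$$ Then the cyclic polytope $\mathcal C_d(n)$ is not (strongly) $(1,d-1)$-scribable.
   Context: The cyclic $d$-polytope $\mathcal C_d(n)$ ($n\ge d+1$) is the combinatorial type of $\operatorname{conv}(\gamma(t_1),\dots,\gamma(t_n))$ for $t_1<\dots<t_n$, where $\gamma(t)=(t,t^2,\dots,t^d)$ is the moment curve in $\mathbb R^d$. The constant $c_m$: a set of closed spherical caps on an $m$-dimensional sphere is a $k$-ply system if no point of the sphere is in the interior of $k$ of the caps. Its intersection graph has the caps as vertices, with two caps adjacent if they intersect. Here $c_m$ denotes a constant (depending only on $m$) for which the Sphere Separator Theorem holds: the intersection graph of any $k$-ply system of $n$ caps on an $m$-dimensional sphere can be separated into two disjoint parts (with no edges between them), each of size at most $\frac{m+1}{m+2}n$, by removing at most $c_m k^{1/m}n^{1-1/m}$ vertices. Scribability: Let $\mathbb S^d=\{x\in\mathbb R^{d+1}:\|x\|_2=1\}$, with coordinates $x_0,\dots,x_d$. A spherical polytope is an intersection of finitely many closed hemispheres of $\mathbb S^d$ containing no two antipodal points; equivalently, $\mathcal P=\mathcal K\cap\mathbb S^d$ for a pointed polyhedral cone $\mathcal K\subset\mathbb R^{d+1}$. Its $k$-faces are the intersections with $\mathbb S^d$ of the $(k+1)$-dimensional faces of $\mathcal K$. A $d$-polytope is a polytope of dimension $d$. A realization of a combinatorial type of $d$-polytope is a spherical $d$-polytope in $\mathbb S^d$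 with isomorphic face lattice. Let $\mathcal B=\{x\in\mathbb S^d: x_0\ge 0,\ -x_0^2+x_1^2+\dots+x_d^2\le 0\}$ and $\mathcal S=\partial\mathcal B$. A supporting hyperplane of $\mathcal P$ is a hyperplane $H$ of $\mathbb S^d$ that meets $\mathcal P$ and such that $\mathcal P$ lies in one of the two closed hemispheres bounded by $H$, denoted $H^-$. A proper face $F$ strongly cuts $\mathcal S$ if $\operatorname{relint}(F)\cap\mathcal B\ne\emptyset$; it strongly avoids $\mathcal S$ if there is a supporting hyperplane $H$ of $\mathcal P$ with $F=H\cap\mathcal P$ and $\mathcal B\subset H^-$. For $0\le i\le j\le d-1$, $\mathcal P$ is (strongly) $(i,j)$-scribed if every $i$-face strongly avoids $\mathcal S$ and every $j$-face strongly cuts $\mathcal S$; a combinatorial type is (strongly) $(i,j)$-scribable if it has a strongly $(i,j)$-scribed realization. *)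

theory Defs
  imports "HOL-Analysis.Analysis"
begin

section \<open>Cyclic polytopes\<close>

text \<open>The coordinates of \<open>real ^ 'd\<close> are indexed by an arbitrary finite type; \<open>to_nat_on UNIV\<close>
  enumerates it by \<open>{..<CARD('d)}\<close>, so the exponents run through \<open>1, \<dots>, CARD('d)\<close>.\<close>

definition moment_curve :: "real \<Rightarrow> real ^ 'd" where
  "moment_curve t = (\<chi> i. t ^ Suc (to_nat_on (UNIV :: 'd set) i))"

definition cyclic_polytope :: "nat \<Rightarrow> (real ^ 'd) set \<Rightarrow> bool" where
  "cyclic_polytope n Q \<longleftrightarrow> CARD('d) + 1 \<le> n \<and>
     (\<exists>t. strict_mono_on {1..n} t \<and> Q = convex hull ((\<lambda>i. moment_curve (t i)) ` {1..n}))"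

section \<open>The sphere separator theorem\<close>

text \<open>Everything takes place on the unit sphere of \<open>'a\<close>, whose dimension is \<open>DIM('a) - 1\<close>.
  Caps are neither single points nor the whole sphere; they may exceed a hemisphere.\<close>

definition spherical_cap :: "'a::euclidean_space set \<Rightarrow> bool" where
  "spherical_cap C \<longleftrightarrow>
     (\<exists>p r. norm p = 1 \<and> -1 < r \<and> r < 1 \<and> C = {x \<in> sphere 0 1. r \<le> p \<bullet> x})"

definition ply_system :: "nat \<Rightarrow> 'a::euclidean_space set set \<Rightarrow> bool" where
  "ply_system k \<C> \<longleftrightarrow> finite \<C> \<and> (\<forall>C\<in>\<C>. spherical_cap C) \<and>
     \<not> (\<exists>x\<in>sphere 0 1. k \<le> card {C \<in> \<C>. x \<in> top_of_set (sphere 0 1) interior_of C})"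

definition cap_adjacent :: "'a set \<Rightarrow> 'a set \<Rightarrow> bool" where
  "cap_adjacent C D \<longleftrightarrow> C \<noteq> D \<and> C \<inter> D \<noteq> {}"

text \<open>\<open>c\<close> is an admissible constant in the sphere separator theorem in dimension \<open>m = DIM('a) - 1\<close>:
  \<open>X\<close> is the set of removed vertices, \<open>A\<close> and \<open>B\<close> are the two parts.\<close>

definition sphere_separator_constant :: "'a::euclidean_space itself \<Rightarrow> real \<Rightarrow> bool" where
  "sphere_separator_constant _ c \<longleftrightarrow>
     (let m = real (DIM('a) - 1) in
      \<forall>k (\<C> :: 'a set set). ply_system k \<C> \<longrightarrow>
        (\<exists>X A B. X \<union> A \<union> B = \<C> \<and> X \<inter> A = {} \<and> X \<inter> B = {} \<and> A \<inter> B = {} \<and>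
           (\<forall>C\<in>A. \<forall>D\<in>B. \<not> cap_adjacent C D) \<and>
           real (card A) \<le> (m + 1) / (m + 2) * real (card \<C>) \<and>
           real (card B) \<le> (m + 1) / (m + 2) * real (card \<C>) \<and>
           real (card X) \<le> c * real k powr (1 / m) * real (card \<C>) powr (1 - 1 / m)))"

section \<open>Spherical polytopes\<close>

definition spherical_polytope :: "'a::euclidean_space set \<Rightarrow> bool" where
  "spherical_polytope P \<longleftrightarrow>
     (\<exists>A. finite A \<and> 0 \<notin> A \<and> P = {x \<in> sphere 0 1. \<forall>a\<in>A. a \<bullet> x \<le> 0}) \<and>
     \<not> (\<exists>x\<in>P. - x \<in> P)"

text \<open>The cone \<open>K\<close> with \<open>P = K \<inter> sphere 0 1\<close>; the origin is inserted because
  \<open>cone hull {} = {}\<close>.\<close>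

definition cone_over :: "'a::euclidean_space set \<Rightarrow> 'a set" where
  "cone_over P = insert 0 (cone hull P)"

definition sph_dim :: "'a::euclidean_space set \<Rightarrow> int" where
  "sph_dim P = aff_dim (cone_over P) - 1"

text \<open>The empty face (from the apex of the cone) and \<open>P\<close> itself belong to the face lattice.\<close>

definition sph_faces :: "'a::euclidean_space set \<Rightarrow> 'a set set" where
  "sph_faces P = {G \<inter> sphere 0 1 | G. G face_of cone_over P}"

definition sph_k_face :: "nat \<Rightarrow> 'a::euclidean_space set \<Rightarrow> 'a set \<Rightarrow> bool" where
  "sph_k_face k F P \<longleftrightarrow>
     (\<exists>G. G face_of cone_over P \<and> aff_dim G = int k + 1 \<and> F = G \<inter> sphere 0 1)"

text \<open>The relative interior of a spherical face, i.e. its interior in the great subsphere it spans.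
  The library's \<open>rel_interior\<close> refers to the affine hull, so it has to be taken for the cone.\<close>

definition sph_rel_interior :: "'a::euclidean_space set \<Rightarrow> 'a set" where
  "sph_rel_interior F = rel_interior (cone_over F) \<inter> sphere 0 1"

section \<open>Scribability\<close>

text \<open>The ambient space of \<open>\<S>\<^sup>d\<close> is \<open>real \<times> (real ^ 'd)\<close>: \<open>x\<^sub>0\<close> is the first component and
  \<open>(x\<^sub>1, \<dots>, x\<^sub>d)\<close> the second.\<close>

definition scribing_ball :: "(real \<times> (real ^ 'd)) set" where
  "scribing_ball =
     {x \<in> sphere 0 1. 0 \<le> fst x \<and> - (fst x)\<^sup>2 + (\<Sum>i\<in>UNIV. (snd x $ i)\<^sup>2) \<le> 0}"

definition strongly_cuts :: "(real \<times> (real ^ 'd)) set \<Rightarrow> bool" where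
  "strongly_cuts F \<longleftrightarrow> sph_rel_interior F \<inter> scribing_ball \<noteq> {}"

text \<open>A supporting hyperplane is given by a normal vector \<open>a\<close>, oriented such that
  \<open>H\<^sup>- = {x. a \<bullet> x \<le> 0}\<close>.\<close>

definition supporting_normal :: "'a::euclidean_space \<Rightarrow> 'a set \<Rightarrow> bool" where
  "supporting_normal a P \<longleftrightarrow> a \<noteq> 0 \<and> P \<inter> {x. a \<bullet> x = 0} \<noteq> {} \<and> P \<subseteq> {x. a \<bullet> x \<le> 0}"

definition strongly_avoids :: "(real \<times> (real ^ 'd)) set \<Rightarrow> (real \<times> (real ^ 'd)) set \<Rightarrow> bool" where
  "strongly_avoids P F \<longleftrightarrow>
     (\<exists>a. supporting_normal a P \<and> F = {x. a \<bullet> x = 0} \<inter> P \<and> scribing_ball \<subseteq> {x. a \<bullet> x \<le> 0})"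

definition strongly_scribed :: "nat \<Rightarrow> nat \<Rightarrow> (real \<times> (real ^ 'd)) set \<Rightarrow> bool" where
  "strongly_scribed i j P \<longleftrightarrow>
     (\<forall>F. sph_k_face i F P \<longrightarrow> strongly_avoids P F) \<and>
     (\<forall>F. sph_k_face j F P \<longrightarrow> strongly_cuts F)"

text \<open>A combinatorial type of \<open>d\<close>-polytopes is represented by a polytope \<open>Q\<close> in \<open>real ^ 'd\<close>.\<close>

definition realizes :: "(real \<times> (real ^ 'd)) set \<Rightarrow> (real ^ 'd) set \<Rightarrow> bool" where
  "realizes P Q \<longleftrightarrow> spherical_polytope P \<and> sph_dim P = int CARD('d) \<and>
     (\<exists>f. bij_betw f {F. F face_of Q} (sph_faces P) \<and>
          (\<forall>F G. F face_of Q \<longrightarrow> G face_of Q \<longrightarrow> (F \<subseteq> G \<longleftrightarrow> f F \<subseteq> f G)))"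

definition strongly_scribable :: "nat \<Rightarrow> nat \<Rightarrow> (real ^ 'd) set \<Rightarrow> bool" where
  "strongly_scribable i j Q \<longleftrightarrow> (\<exists>P. realizes P Q \<and> strongly_scribed i j P)"

end

theory Submission
  imports Defs
begin

text \<open>Every vertex of a strongly \<open>(1, d - 1)\<close>-scribed realization sees a cap of the sphere. As \<open>d \<ge> 4\<close>,
  any two vertices span an edge, and a hyperplane that supports this edge and has the ball on one side
  forces their caps to intersect. The intersection graph is complete, so a separator contains at
  least \<open>n / (d + 1)\<close> of the caps; the bound on \<open>n\<close> follows once no point lies in the interior of
  \<open>3 * d / 2 - 1\<close> caps.

  The vertices whose caps contain a given point in the interior are cut off by the tangent hyperplane
  there. Cyclic polytopes of even dimension are rigid: in every realization the circuits alternate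
  along the cyclic order of the vertices. So a set cut off by a hyperplane consists of at most \<open>d / 2\<close>
  cyclic intervals, and if it has \<open>3 * d / 2 - 1\<close> elements, it contains \<open>d / 2\<close> disjoint pairs of
  neighbours, that is, a facet by Gale's evenness condition. But this facet cuts the ball.\<close>

section \<open>Circuits of neighborly configurations\<close>

text \<open>A realization carries no moment curve, only a face lattice, so Gale's sign rules cannot
  be read off from Vandermonde determinants. What the lattice supplies are functionals that vanish
  on a union of at most m = d / 2 blocks and are negative at all other vertices. Singleton blocks
  encode neighborliness and force every nonzero linear relation among the vertex vectors to have at
  least m + 1 coefficients of each sign; pair blocks forbid equal signs at neighbours in a circuit.
  Alternation follows from these two facts. The size 3 * m - 1 is the least for which the count
  works: m - 1 disjoint pairs and m leftover elements make only 3 * m - 2, whereas one more element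
  yields m pairs or m + 1 leftovers, and so many intervals contradict alternation. The separator
  theorem speaks of a set of proper caps. So the vertices must also be shown to lie outside the ball
  and its antipode, by comparing two edges at a vertex, and distinct vertices must be shown to have
  distinct caps.\<close>

definition cyclic_blocks :: "nat \<Rightarrow> nat set set" where
  "cyclic_blocks n = (\<lambda>i. {i}) ` {..<n} \<union> (\<lambda>i. {i, Suc i mod n}) ` {..<n}"

lemma finite_cyclic_blocks [simp]: "finite (cyclic_blocks n)"
  by (simp add: cyclic_blocks_def)

lemma singletons_subset_cyclic_blocks: "I \<subseteq> {..<n} \<Longrightarrow> (\<lambda>i. {i}) ` I \<subseteq> cyclic_blocks n"
  by (auto simp: cyclic_blocks_def)

lemma Union_cyclic_blocks_subset: "K \<subseteq> cyclic_blocks n \<Longrightarrow> \<Union>K \<subseteq> {..<n}"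
  by (force simp: cyclic_blocks_def)

text \<open>\<open>dependent\<close> sees only the image set, where equal vectors go unnoticed; that
  case is served by the relation \<open>v i - v j = 0\<close>. Coefficients vanish outside
  \<open>T\<close> so that sums over \<open>T\<close> extend to all indices.\<close>

lemma nontrivial_relation:
  fixes v :: "nat \<Rightarrow> 'a::euclidean_space"
  assumes "finite T" "v ` T \<subseteq> U" "dim U < card T"
  obtains c where "\<exists>i\<in>T. c i \<noteq> 0" "\<And>i. i \<notin> T \<Longrightarrow> c i = 0" "(\<Sum>i\<in>T. c i *\<^sub>R v i) = 0"
proof (cases "inj_on v T")
  case True
  have "dependent (v ` T)"
    using independent_card_le_dim[OF assms(2)] assms(3) card_image[OF True] by fastforce
  then obtain u where u: "\<exists>x\<in>v ` T. u x \<noteq> 0" "(\<Sum>x\<in>v ` T. u x *\<^sub>R x) = 0"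
    using dependent_finite[of "v ` T"] assms(1) by auto
  have eq: "(\<Sum>i\<in>T. u (v i) *\<^sub>R v i) = 0"
    using u(2) sum.reindex[OF True, of "\<lambda>x. u x *\<^sub>R x"] by simp
  show ?thesis
    by (rule that[of "\<lambda>i. if i \<in> T then u (v i) else 0"]) (use u(1) eq in auto)
next
  case False
  then obtain i j where ij: "i \<in> T" "j \<in> T" "i \<noteq> j" "v i = v j"
    by (auto simp: inj_on_def)
  let ?c = "\<lambda>k. if k = i then 1 else if k = j then -1 else 0 :: real"
  have "(\<Sum>k\<in>T. ?c k *\<^sub>R v k) = (\<Sum>k\<in>{i,j}. ?c k *\<^sub>R v k)"
    by (rule sum.mono_neutral_right) (use ij assms(1) in auto)
  also have "\<dots> = 0"
    using ij by simp
  finally show ?thesis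
    by (intro that[of ?c]) (use ij in auto)
qed

text \<open>Pairs {x, Suc x} are split off from the left, \<open>M\<close> collecting the lower
  ends. A leftover followed by an element of \<open>W\<close> would have been paired with it, so
  each maximal run of \<open>W\<close> leaves at most its last element in \<open>U\<close>.\<close>

lemma obtain_greedy_matching:
  fixes W :: "nat set"
  assumes "finite W"
  obtains M U where "finite M" "finite U" "M \<inter> Suc ` M = {}" "W = M \<union> Suc ` M \<union> U"
    "U \<inter> (M \<union> Suc ` M) = {}" "\<And>u. u \<in> U \<Longrightarrow> Suc u \<notin> W"
proof -
  have "\<exists>M U. finite M \<and> finite U \<and> M \<inter> Suc ` M = {} \<and> W = M \<union> Suc ` M \<union> U \<and>
        U \<inter> (M \<union> Suc ` M) = {} \<and> (\<forall>u\<in>U. Suc u \<notin> W)"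
    using assms
  proof (induction "card W" arbitrary: W rule: less_induct)
    case less
    show ?case
    proof (cases "W = {}")
      case True
      then show ?thesis
        by (intro exI[of _ "{}"]) auto
    next
      case False
      define x where "x = Min W"
      have x: "x \<in> W" and xle: "\<And>y. y \<in> W \<Longrightarrow> x \<le> y"
        using False less.prems by (auto simp: x_def)
      define W' where "W' = W - {x, Suc x}"
      have "card W' < card W"
        unfolding W'_def by (rule psubset_card_mono) (use x less.prems in auto)
      moreover have "finite W'"
        using less.prems by (simp add: W'_def)
      ultimately obtain M U where MU: "finite M" "finite U" "M \<inter> Suc ` M = {}"
          "W' = M \<union> Suc ` M \<union> U" "U \<inter> (M \<union> Suc ` M) = {}" "\<forall>u\<in>U. Suc u \<notin> W'"
        using less.hyps[of W'] by blast
      have gt: "Suc x < y" if "y \<in> W'" for y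
        using that xle[of y] by (auto simp: W'_def)
      have gtM: "y \<in> M \<Longrightarrow> Suc x < y" and gtU: "y \<in> U \<Longrightarrow> Suc x < y" for y
        using gt MU(4) by auto
      have U_W: "Suc u \<notin> W" if "u \<in> U" for u
        using MU(6) that gtU[OF that] by (auto simp: W'_def)
      show ?thesis
      proof (cases "Suc x \<in> W")
        case True
        have W: "W = insert x M \<union> Suc ` insert x M \<union> U"
          using MU(4) x True by (auto simp: W'_def)
        show ?thesis
        proof (rule exI[of _ "insert x M"], rule exI[of _ U], intro conjI)
          show "insert x M \<inter> Suc ` insert x M = {}"
            using MU(3) gtM by (auto dest: gtM)
          show "U \<inter> (insert x M \<union> Suc ` insert x M) = {}"
            using MU(5) by (auto dest: gtU)
        qed (use MU(1,2) W U_W in auto)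
      next
        case False
        have W: "W = M \<union> Suc ` M \<union> insert x U"
          using MU(4) x False by (auto simp: W'_def)
        show ?thesis
        proof (rule exI[of _ M], rule exI[of _ "insert x U"], intro conjI)
          show "insert x U \<inter> (M \<union> Suc ` M) = {}"
            using MU(5) by (auto dest: gtM)
        qed (use MU(1,2,3) W U_W False in auto)
      qed
    qed
  qed
  then obtain M U where "finite M \<and> finite U \<and> M \<inter> Suc ` M = {} \<and> W = M \<union> Suc ` M \<union> U \<and>
      U \<inter> (M \<union> Suc ` M) = {} \<and> (\<forall>u\<in>U. Suc u \<notin> W)"
    by (elim exE)
  then show ?thesis
    by (intro that[of M U]) blast+
qed

text \<open>The blocks play the role of double roots: a product of \<open>m\<close> of them is a polynomial of degree
  \<open>2 * m\<close> that is nonnegative on the parameters of the vertices.\<close>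

locale cyclic_configuration =
  fixes m n :: nat and v :: "nat \<Rightarrow> 'a::euclidean_space"
  assumes dim: "DIM('a) = 2 * m + 1" and n: "2 * m + 1 \<le> n" and m: "1 \<le> m"
    and support: "\<And>K. K \<subseteq> cyclic_blocks n \<Longrightarrow> card K \<le> m \<Longrightarrow>
      \<exists>g. \<forall>i<n. if i \<in> \<Union>K then g \<bullet> v i = 0 else g \<bullet> v i < 0"
begin

text \<open>Evaluate the relation at a functional \<open>g\<close> exposing the face. On the
  positive part \<open>g\<close> vanishes, and elsewhere coefficient and value are both at most 0.
  So the terms are nonnegative with sum 0, and no coefficient can be negative.\<close>

lemma positive_part_not_face:
  assumes rel: "(\<Sum>i<n. c i *\<^sub>R v i) = 0" and K: "K \<subseteq> cyclic_blocks n" "card K \<le> m"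
    and pos: "{i. i < n \<and> 0 < c i} = \<Union>K" and "i < n"
  shows "c i = 0"
proof -
  have sum0: "(\<Sum>i<n. c i * (g \<bullet> v i)) = 0" for g
  proof -
    have "g \<bullet> (\<Sum>i<n. c i *\<^sub>R v i) = 0"
      using rel by simp
    then show ?thesis
      by (simp add: inner_sum_right)
  qed
  obtain g where g: "\<forall>i<n. if i \<in> \<Union>K then g \<bullet> v i = 0 else g \<bullet> v i < 0"
    using support[OF K] by blast
  have nonneg: "0 \<le> c i * (g \<bullet> v i)" if "i < n" for i
  proof (cases "i \<in> \<Union>K")
    case False
    then have "c i \<le> 0" "g \<bullet> v i < 0"
      using pos that g by (auto simp: not_less[symmetric])
    then show ?thesis
      by (simp add: mult_nonpos_nonpos)
  qed (use g that in auto)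
  have cnn: "0 \<le> c i" if "i < n" for i
  proof (cases "i \<in> \<Union>K")
    case True
    then have "i \<in> {i. i < n \<and> 0 < c i}" unfolding pos .
    then show ?thesis by simp
  next
    case False
    have "c i * (g \<bullet> v i) = 0"
      using sum_nonneg_eq_0_iff[of "{..<n}" "\<lambda>i. c i * (g \<bullet> v i)"] sum0 nonneg that by auto
    then show ?thesis
      using g that False by auto
  qed
  \<comment> \<open>The empty face yields a functional that is negative on all vectors; a relation
    with nonnegative coefficients is therefore trivial.\<close>
  obtain h where h: "\<forall>i<n. h \<bullet> v i < 0"
    using support[of "{}"] by auto
  have "c i * (h \<bullet> v i) \<le> 0" if "i < n" for i
    using h cnn that by (simp add: mult_nonneg_nonpos less_imp_le)
  then have "c i * (h \<bullet> v i) = 0"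
    using sum_nonneg_eq_0_iff[of "{..<n}" "\<lambda>i. - (c i * (h \<bullet> v i))"] sum0 \<open>i < n\<close>
    by (auto simp: sum_negf)
  then show ?thesis
    using h \<open>i < n\<close> by auto
qed

text \<open>Neighborliness: up to \<open>m\<close> indices are covered by as many singleton
  blocks.\<close>

lemma card_positive_part:
  assumes rel: "(\<Sum>i<n. c i *\<^sub>R v i) = 0" and "j < n" "c j \<noteq> 0"
  shows "m < card {i. i < n \<and> 0 < c i}"
proof (rule ccontr)
  assume small: "\<not> ?thesis"
  let ?P = "{i. i < n \<and> 0 < c i}"
  have "c j = 0"
  proof (rule positive_part_not_face[OF rel])
    show "(\<lambda>i. {i}) ` ?P \<subseteq> cyclic_blocks n"
      by (rule singletons_subset_cyclic_blocks) auto
    show "card ((\<lambda>i. {i}) ` ?P) \<le> m"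
      using small card_image_le[of ?P "\<lambda>i. {i}"] by simp
  qed (use assms in auto)
  with assms show False by simp
qed

lemma uminus_relation: "(\<Sum>i<n. c i *\<^sub>R v i) = 0 \<Longrightarrow> (\<Sum>i<n. (- c i) *\<^sub>R v i) = 0"
  by (simp add: sum_negf)

lemma card_negative_part:
  assumes rel: "(\<Sum>i<n. c i *\<^sub>R v i) = 0" and "j < n" "c j \<noteq> 0"
  shows "m < card {i. i < n \<and> c i < 0}"
  using card_positive_part[OF uminus_relation[OF rel], of j] assms by simp

lemma card_support_split:
  assumes "\<And>i. i \<notin> S \<Longrightarrow> c i = (0::real)" "S \<subseteq> {..<n}"
  shows "card {i. i < n \<and> 0 < c i} + card {i. i < n \<and> c i < 0} = card {i\<in>S. c i \<noteq> 0}"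
proof -
  have "card ({i. i < n \<and> 0 < c i} \<union> {i. i < n \<and> c i < 0}) =
      card {i. i < n \<and> 0 < c i} + card {i. i < n \<and> c i < 0}"
    by (rule card_Un_disjoint) auto
  moreover have "{i. i < n \<and> 0 < c i} \<union> {i. i < n \<and> c i < 0} = {i\<in>S. c i \<noteq> 0}"
    using assms by (auto simp: neq_iff) (metis order.irrefl)+
  ultimately show ?thesis by simp
qed

text \<open>A nonzero relation has at least \<open>m + 1\<close> coefficients of each sign, hence at
  least \<open>2 * m + 2\<close> vectors in its support.\<close>

lemma general_position:
  assumes "S \<subseteq> {..<n}" "card S \<le> 2 * m + 1" "\<And>i. i \<notin> S \<Longrightarrow> c i = 0"
    and "(\<Sum>i\<in>S. c i *\<^sub>R v i) = 0"
  shows "c i = 0"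
proof (rule ccontr)
  assume i: "c i \<noteq> 0"
  then have "i < n" using assms by auto
  have rel: "(\<Sum>i<n. c i *\<^sub>R v i) = 0"
    using assms by (subst sum.mono_neutral_right[of "{..<n}" S]) auto
  have "card {i\<in>S. c i \<noteq> 0} \<le> card S"
    using assms(1) by (intro card_mono) (auto intro: finite_subset)
  then show False
    using card_positive_part[OF rel \<open>i < n\<close> i] card_negative_part[OF rel \<open>i < n\<close> i]
      card_support_split[of S c, OF assms(3,1)] assms(2) by linarith
qed

lemma inj_and_independent:
  assumes "S \<subseteq> {..<n}" "card S \<le> 2 * m + 1"
  shows "inj_on v S" "independent (v ` S)"
proof -
  have fin: "finite S" using assms(1) finite_subset by blast
  show inj: "inj_on v S"
  proof (rule inj_onI, rule ccontr)
    fix i j assume ij: "i \<in> S" "j \<in> S" "v i = v j" "i \<noteq> j"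
    let ?c = "\<lambda>k. if k = i then 1 else if k = j then -1 else 0 :: real"
    have "?c i = 0"
    proof (rule general_position[OF assms, of ?c])
      have "(\<Sum>k\<in>S. ?c k *\<^sub>R v k) = (\<Sum>k\<in>{i,j}. ?c k *\<^sub>R v k)"
        by (rule sum.mono_neutral_right) (use ij fin in auto)
      then show "(\<Sum>k\<in>S. ?c k *\<^sub>R v k) = 0"
        using ij by simp
    qed (use ij in auto)
    then show False by simp
  qed
  show "independent (v ` S)"
  proof
    assume "dependent (v ` S)"
    then obtain u where u: "\<exists>x\<in>v ` S. u x \<noteq> 0" "(\<Sum>x\<in>v ` S. u x *\<^sub>R x) = 0"
      using dependent_finite[of "v ` S"] fin by auto
    then obtain j where j: "j \<in> S" "u (v j) \<noteq> 0" by auto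
    let ?c = "\<lambda>k. if k \<in> S then u (v k) else 0"
    have "?c j = 0"
    proof (rule general_position[OF assms, of ?c])
      show "(\<Sum>k\<in>S. ?c k *\<^sub>R v k) = 0"
        using u(2) sum.reindex[OF inj, of "\<lambda>x. u x *\<^sub>R x"] by simp
    qed auto
    then show False using j by simp
  qed
qed

text \<open>The lower bound \<open>m + 1\<close> for each sign already accounts for
  \<open>2 * m + 2\<close> indices, so nothing in \<open>S\<close> is left over and the signs are
  balanced.\<close>

lemma circuit_support:
  assumes "S \<subseteq> {..<n}" "card S \<le> 2 * m + 2" "\<And>i. i \<notin> S \<Longrightarrow> c i = 0"
    and "(\<Sum>i\<in>S. c i *\<^sub>R v i) = 0" "c j \<noteq> 0"
  shows "\<And>i. i \<in> S \<Longrightarrow> c i \<noteq> 0" "card {i. i < n \<and> 0 < c i} = m + 1"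
proof -
  have fin: "finite S" using assms(1) finite_subset by blast
  have "j < n" using assms by auto
  have rel: "(\<Sum>i<n. c i *\<^sub>R v i) = 0"
    using assms by (subst sum.mono_neutral_right[of "{..<n}" S]) auto
  note cards = card_positive_part[OF rel \<open>j < n\<close> assms(5)] card_negative_part[OF rel \<open>j < n\<close> assms(5)]
      card_support_split[of S c, OF assms(3,1)]
  have le: "card {i\<in>S. c i \<noteq> 0} \<le> card S"
    using fin by (intro card_mono) auto
  then show "card {i. i < n \<and> 0 < c i} = m + 1"
    using cards assms(2) by linarith
  have "card {i\<in>S. c i \<noteq> 0} = card S"
    using le cards assms(2) by linarith
  then have "{i\<in>S. c i \<noteq> 0} = S"
    using fin by (intro card_subset_eq) auto
  then show "\<And>i. i \<in> S \<Longrightarrow> c i \<noteq> 0" by auto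
qed

text \<open>A positive part of \<open>m + 1\<close> elements is one too large for singleton blocks,
  but two neighbours in it could share a block, and then \<open>m\<close> blocks would make it a
  face.\<close>

lemma circuit_consecutive:
  assumes S: "S \<subseteq> {..<n}" "card S \<le> 2 * m + 2" "\<And>i. i \<notin> S \<Longrightarrow> c i = 0"
    and rel: "(\<Sum>i\<in>S. c i *\<^sub>R v i) = 0" and q: "Suc q < n"
  shows "\<not> (0 < c q \<and> 0 < c (Suc q))"
proof
  assume pos: "0 < c q \<and> 0 < c (Suc q)"
  let ?P = "{i. i < n \<and> 0 < c i}"
  have card: "card ?P = m + 1"
    by (rule circuit_support(2)[OF assms(1-4), of q]) (use pos in auto)
  define K where "K = insert {q, Suc q} ((\<lambda>i. {i}) ` (?P - {q, Suc q}))"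
  have rel': "(\<Sum>i<n. c i *\<^sub>R v i) = 0"
    using S rel by (subst sum.mono_neutral_right[of "{..<n}" S]) auto
  have "c q = 0"
  proof (rule positive_part_not_face[OF rel'])
    have "{q, Suc q} \<in> cyclic_blocks n"
      using q by (auto simp: cyclic_blocks_def intro!: image_eqI[of _ _ q])
    moreover have "(\<lambda>i. {i}) ` (?P - {q, Suc q}) \<subseteq> cyclic_blocks n"
      by (rule singletons_subset_cyclic_blocks) auto
    ultimately show "K \<subseteq> cyclic_blocks n"
      by (simp add: K_def)
    have "card (?P - {q, Suc q}) = card ?P - card {q, Suc q}"
      by (rule card_Diff_subset) (use pos q in auto)
    then have "card ((\<lambda>i. {i}) ` (?P - {q, Suc q})) \<le> m - 1"
      using card card_image_le[of "?P - {q, Suc q}" "\<lambda>i. {i}"] by simp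
    then show "card K \<le> m"
      unfolding K_def using card_insert_le_m1[of m] m by simp
    show "?P = \<Union>K"
      using pos q by (auto simp: K_def)
    show "q < n" using q by simp
  qed
  then show False using pos by simp
qed

lemma functional_vanishing_on:
  assumes S: "S \<subseteq> {..<n}" "card S = 2 * m"
  obtains f where "f \<noteq> 0" "\<And>i. i \<in> S \<Longrightarrow> f \<bullet> v i = 0" "\<And>i. i < n \<Longrightarrow> i \<notin> S \<Longrightarrow> f \<bullet> v i \<noteq> 0"
proof -
  have fin: "finite S" using S finite_subset by blast
  have "dim (v ` S) \<le> card (v ` S)"
    using fin by (intro dim_le_card') auto
  also have "\<dots> \<le> 2 * m"
    using S fin card_image_le by metis
  finally have "dim (v ` S) < DIM('a)"
    using dim by simp
  then obtain f where f: "f \<noteq> 0" "span (v ` S) \<subseteq> {x. f \<bullet> x = 0}"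
    using lowdim_subset_hyperplane by blast
  have f0: "f \<bullet> v i = 0" if "i \<in> S" for i
    using f(2) span_base[of "v i" "v ` S"] that by auto
  \<comment> \<open>Otherwise \<open>2 * m + 1\<close> of the vectors would lie in a hyperplane of
    dimension \<open>2 * m\<close>, against general position.\<close>
  have "f \<bullet> v i \<noteq> 0" if i: "i < n" "i \<notin> S" for i
  proof
    assume fi: "f \<bullet> v i = 0"
    have "dim {x. f \<bullet> x = 0} = DIM('a) - 1"
      using f(1) by (rule dim_hyperplane)
    then obtain c where c: "\<exists>k\<in>insert i S. c k \<noteq> 0" "\<And>k. k \<notin> insert i S \<Longrightarrow> c k = 0"
        "(\<Sum>k\<in>insert i S. c k *\<^sub>R v k) = 0"
      using nontrivial_relation[of "insert i S" v "{x. f \<bullet> x = 0}"] fi f0 fin i S(2) dim by auto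
    then show False
      using general_position[of "insert i S" c] S i fin by auto
  qed
  then show ?thesis using that f(1) f0 by blast
qed

text \<open>The hyperplane spanned by \<open>2 * m\<close> of the vectors never separates \<open>v q\<close> from
  \<open>v (Suc q)\<close>: otherwise the circuit on these \<open>2 * m + 2\<close> vectors would give both the same sign,
  although they lie on a common face with any \<open>m - 1\<close> others.\<close>

lemma functional_consecutive:
  assumes S: "S \<subseteq> {..<n}" "card S = 2 * m" and f: "\<And>i. i \<in> S \<Longrightarrow> f \<bullet> v i = 0"
    "\<And>i. i < n \<Longrightarrow> i \<notin> S \<Longrightarrow> f \<bullet> v i \<noteq> 0"
    and q: "Suc q < n" "q \<notin> S" "Suc q \<notin> S"
  shows "0 < (f \<bullet> v q) * (f \<bullet> v (Suc q))"
proof (rule ccontr)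
  assume "\<not> ?thesis"
  moreover have nz: "f \<bullet> v q \<noteq> 0" "f \<bullet> v (Suc q) \<noteq> 0"
    using f(2) q by auto
  ultimately have neg: "(f \<bullet> v q) * (f \<bullet> v (Suc q)) < 0"
    by (simp add: not_less order_le_less)
  define T where "T = insert q (insert (Suc q) S)"
  have fin: "finite S" using S finite_subset by blast
  have T: "T \<subseteq> {..<n}" "card T = 2 * m + 2" "finite T"
    using S q fin by (auto simp: T_def)
  have "dim (UNIV :: 'a set) < card T"
    using dim T by simp
  then obtain c where c: "\<exists>k\<in>T. c k \<noteq> 0" "\<And>k. k \<notin> T \<Longrightarrow> c k = 0"
      "(\<Sum>k\<in>T. c k *\<^sub>R v k) = 0"
    using nontrivial_relation[of T v UNIV] T by auto
  then obtain j where j: "c j \<noteq> 0" by auto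
  have cnz: "c q \<noteq> 0" "c (Suc q) \<noteq> 0"
    using circuit_support(1)[OF T(1) _ c(2,3) j] T by (auto simp: T_def)
  \<comment> \<open>On \<open>T\<close> only \<open>q\<close> and \<open>Suc q\<close> contribute;
    as \<open>f\<close> has opposite signs there, the coefficients must agree in sign.\<close>
  have "f \<bullet> (\<Sum>k\<in>T. c k *\<^sub>R v k) = 0"
    using c(3) by simp
  then have "(\<Sum>k\<in>T. c k * (f \<bullet> v k)) = 0"
    by (simp add: inner_sum_right)
  then have eq: "c q * (f \<bullet> v q) + c (Suc q) * (f \<bullet> v (Suc q)) = 0"
    using fin q f(1) by (simp add: T_def)
  have same: "0 < c q * c (Suc q)"
  proof (rule ccontr)
    assume "\<not> 0 < c q * c (Suc q)"
    then have "0 \<le> (c q * c (Suc q)) * ((f \<bullet> v q) * (f \<bullet> v (Suc q)))"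
      using neg by (simp add: mult_nonpos_nonpos)
    also have "\<dots> = (c q * (f \<bullet> v q)) * (c (Suc q) * (f \<bullet> v (Suc q)))"
      by (simp add: algebra_simps)
    also have "\<dots> = - (c q * (f \<bullet> v q))\<^sup>2"
    proof -
      have "c (Suc q) * (f \<bullet> v (Suc q)) = - (c q * (f \<bullet> v q))" using eq by linarith
      then show ?thesis by (simp add: power2_eq_square)
    qed
    finally show False using cnz nz by simp
  qed
  have "\<not> (0 < c q \<and> 0 < c (Suc q))"
    by (rule circuit_consecutive[OF T(1) _ c(2,3) q(1)]) (use T in auto)
  moreover have "\<not> (0 < - c q \<and> 0 < - c (Suc q))"
    by (rule circuit_consecutive[of T "\<lambda>i. - c i", OF T(1) _ _ _ q(1)])
      (use T c in \<open>auto simp: sum_negf\<close>)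
  ultimately show False
    using same by (auto simp: zero_less_mult_iff)
qed

lemma functional_interval:
  assumes S: "S \<subseteq> {..<n}" "card S = 2 * m" and f: "\<And>i. i \<in> S \<Longrightarrow> f \<bullet> v i = 0"
    "\<And>i. i < n \<Longrightarrow> i \<notin> S \<Longrightarrow> f \<bullet> v i \<noteq> 0"
    and "a \<le> b" "b < n" "{a..b} \<inter> S = {}"
  shows "0 < (f \<bullet> v a) * (f \<bullet> v b)"
  using assms(5-7)
proof (induction b)
  case 0
  then have "f \<bullet> v 0 \<noteq> 0" by (intro f(2)) auto
  then show ?case using 0 by (auto simp: zero_less_mult_iff neq_iff)
next
  case (Suc b)
  show ?case
  proof (cases "a = Suc b")
    case True
    then have "f \<bullet> v a \<noteq> 0" using Suc.prems by (intro f(2)) auto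
    then show ?thesis using True by (auto simp: zero_less_mult_iff neq_iff)
  next
    case False
    then have "a \<le> b" using Suc.prems by simp
    then have "b \<in> {a..Suc b}" "Suc b \<in> {a..Suc b}" by auto
    then have "b \<notin> S" "Suc b \<notin> S"
      using Suc.prems(3) by blast+
    then have "0 < (f \<bullet> v b) * (f \<bullet> v (Suc b))"
      using functional_consecutive[OF S f] Suc.prems by auto
    moreover have "0 < (f \<bullet> v a) * (f \<bullet> v b)"
    proof (rule Suc.IH)
      show "{a..b} \<inter> S = {}"
        using Suc.prems(3) by (auto simp: disjoint_iff)
    qed (use Suc.prems \<open>a \<le> b\<close> in auto)
    ultimately show ?thesis
      by (auto simp: zero_less_mult_iff)
  qed
qed

text \<open>At the functional that vanishes on the other \<open>2 * m\<close> elements of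
  \<open>T\<close>, two terms of the relation remain. No index between \<open>a\<close> and
  \<open>b\<close> is in \<open>T\<close>, so the functional does not change its sign from
  \<open>a\<close> to \<open>b\<close>; the coefficients have to compensate.\<close>

lemma circuit_alternates:
  assumes T: "T \<subseteq> {..<n}" "card T = 2 * m + 2" "\<And>i. i \<notin> T \<Longrightarrow> c i = 0"
    and rel: "(\<Sum>i\<in>T. c i *\<^sub>R v i) = 0" "c j \<noteq> 0"
    and ab: "a \<in> T" "b \<in> T" "a < b" "{a<..<b} \<inter> T = {}"
  shows "c a * c b < 0"
proof -
  define S where "S = T - {a, b}"
  have fin: "finite T" using T finite_subset by blast
  have "card S = card T - card {a, b}"
    unfolding S_def by (rule card_Diff_subset) (use ab in auto)
  then have S: "S \<subseteq> {..<n}" "card S = 2 * m"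
    using T ab by (auto simp: S_def)
  obtain f where f: "f \<noteq> 0" "\<And>i. i \<in> S \<Longrightarrow> f \<bullet> v i = 0" "\<And>i. i < n \<Longrightarrow> i \<notin> S \<Longrightarrow> f \<bullet> v i \<noteq> 0"
    using functional_vanishing_on[OF S] by blast
  have disj: "{a..b} \<inter> S = {}"
    using ab by (auto simp: S_def) (metis IntI empty_iff greaterThanLessThan_iff le_neq_implies_less)
  have pos: "0 < (f \<bullet> v a) * (f \<bullet> v b)"
    by (rule functional_interval[OF S f(2,3)]) (use ab T disj in auto)
  have "f \<bullet> (\<Sum>k\<in>T. c k *\<^sub>R v k) = 0"
    using rel by simp
  then have "(\<Sum>k\<in>T. c k * (f \<bullet> v k)) = 0"
    by (simp add: inner_sum_right)
  moreover have "T = insert a (insert b S)"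
    using ab by (auto simp: S_def)
  moreover have "finite S" "a \<notin> S" "b \<notin> S"
    using fin by (auto simp: S_def)
  ultimately have eq: "c a * (f \<bullet> v a) + c b * (f \<bullet> v b) = 0"
    using ab f(2) by simp
  have cnz: "c a \<noteq> 0" "c b \<noteq> 0"
    using circuit_support(1)[OF T(1) _ T(3) rel] T(2) ab by auto
  show ?thesis
  proof (rule ccontr)
    assume "\<not> c a * c b < 0"
    then have "0 < c a * c b" using cnz by (simp add: not_less order_le_less)
    then have "0 < (c a * (f \<bullet> v a)) * (c b * (f \<bullet> v b))"
      using mult_pos_pos[OF \<open>0 < c a * c b\<close> pos] by (simp add: algebra_simps)
    also have "c b * (f \<bullet> v b) = - (c a * (f \<bullet> v a))" using eq by linarith
    finally show False by (simp add: mult_less_0_iff zero_less_mult_iff) 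
  qed
qed

end

section \<open>Facets among the vertices in an open halfspace\<close>

context cyclic_configuration
begin

text \<open>The elements of \<open>U\<close> and their successors carry a circuit whose signs
  alternate, so up to a global sign it is positive on \<open>U\<close> and negative on the
  successors. Then \<open>l\<close> applied to the relation gives a positive number instead of
  0.\<close>

lemma no_alternating_halfspace:
  assumes U: "U \<subseteq> {..<n}" "card U = m + 1"
    and pos: "\<And>u. u \<in> U \<Longrightarrow> 0 < l \<bullet> v u"
    and next_nonpos: "\<And>u. u \<in> U \<Longrightarrow> Suc u < n \<and> l \<bullet> v (Suc u) \<le> 0"
  shows False
proof -
  have fin: "finite U" using U finite_subset by blast
  \<comment> \<open>In increasing order, the elements of \<open>T\<close> below are
    \<open>h 0\<close>, \<open>Suc (h 0)\<close>, \<open>h 1\<close>, \<open>Suc (h 1)\<close>, and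
    so on.\<close>
  obtain h where h: "bij_betw h {..<card U} U" "strict_mono_on {..<card U} h"
    using ex_bij_betw_strict_mono_card[OF fin] by blast
  have hU: "h k \<in> U" if "k \<le> m" for k
    using h(1) that U by (auto simp: bij_betw_def)
  have Uh: "\<exists>k\<le>m. u = h k" if "u \<in> U" for u
    using h(1) that U by (auto simp: bij_betw_def image_iff less_Suc_eq_le)
  have h_less: "h j < h k \<longleftrightarrow> j < k" if "j \<le> m" "k \<le> m" for j k
    using strict_mono_on_less[OF h(2), of j k] that U by auto
  define T where "T = U \<union> Suc ` U"
  have disj: "U \<inter> Suc ` U = {}"
    using pos next_nonpos by fastforce
  have T: "T \<subseteq> {..<n}" "finite T" "card T = 2 * m + 2"
    using U next_nonpos fin disj by (auto simp: T_def card_Un_disjoint card_image)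
  obtain c where c: "\<exists>i\<in>T. c i \<noteq> 0" "\<And>i. i \<notin> T \<Longrightarrow> c i = 0" "(\<Sum>i\<in>T. c i *\<^sub>R v i) = 0"
    using nontrivial_relation[of T v UNIV] T dim by auto
  then obtain j where j: "c j \<noteq> 0" by auto
  have alt: "c a * c b < 0" if "a \<in> T" "b \<in> T" "a < b" "{a<..<b} \<inter> T = {}" for a b
    by (rule circuit_alternates[OF T(1,3) c(2,3) j that])
  have alt1: "c u * c (Suc u) < 0" if "u \<in> U" for u
    by (rule alt) (use that in \<open>auto simp: T_def\<close>)
  have alt2: "c (Suc (h k)) * c (h (Suc k)) < 0" if k: "k < m" for k
  proof (rule alt)
    have mem: "h k \<in> U" "h (Suc k) \<in> U" "h k < h (Suc k)"
      using hU h_less[of k "Suc k"] k by auto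
    then show "Suc (h k) \<in> T" "h (Suc k) \<in> T"
      by (auto simp: T_def)
    have "Suc (h k) \<noteq> h (Suc k)"
      using mem disj by force
    then show "Suc (h k) < h (Suc k)"
      using mem by simp
    show "{Suc (h k)<..<h (Suc k)} \<inter> T = {}"
    proof (rule ccontr)
      assume "\<not> ?thesis"
      then have "\<exists>u\<in>U. h k < u \<and> u < h (Suc k)"
        unfolding T_def using Suc_lessD by fastforce
      then obtain u where "u \<in> U" "h k < u" "u < h (Suc k)"
        by blast
      then obtain i where i: "i \<le> m" "h k < h i" "h i < h (Suc k)"
        using Uh by blast
      then have "k < i" "i < Suc k"
        using h_less[of k i] h_less[of i "Suc k"] k by auto
      then show False by simp
    qed
  qed
  \<comment> \<open>Multiplication by \<open>s\<close> makes the circuit positive at the first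
    element of \<open>U\<close>.\<close>
  define s where "s = sgn (c (h 0))"
  have "c (h 0) \<noteq> 0"
    using alt1[OF hU[of 0]] by auto
  then have s: "0 < s * c (h 0)" "s * s = 1"
    by (auto simp: s_def sgn_if)
  have flip: "(s * a) * (s * b) < 0" if "a * b < 0" for a b :: real
  proof -
    have "(s * a) * (s * b) = (s * s) * (a * b)" by (simp only: ac_simps)
    also have "\<dots> = a * b" unfolding s(2) by simp
    finally show ?thesis using that by (simp only:)
  qed
  have opposite: "0 < y" if "x < 0" "x * y < 0" for x y :: real
    using that by (auto simp: mult_less_0_iff)
  have opposite': "y < 0" if "0 < x" "x * y < 0" for x y :: real
    using that by (auto simp: mult_less_0_iff)
  have "0 < s * c (h k)" if "k \<le> m" for k
    using that
  proof (induction k)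
    case 0
    show ?case by (rule s(1))
  next
    case (Suc k)
    then have "s * c (Suc (h k)) < 0"
      using opposite'[OF _ flip[OF alt1[OF hU[of k]]]] by simp
    then show ?case
      using opposite[OF _ flip[OF alt2[of k]]] Suc.prems by simp
  qed
  then have posU: "0 < s * c u" if "u \<in> U" for u
    using Uh[OF that] by auto
  have negU: "s * c (Suc u) < 0" if "u \<in> U" for u
    using opposite'[OF posU[OF that] flip[OF alt1[OF that]]] .
  have "(l \<bullet> (\<Sum>i\<in>T. c i *\<^sub>R v i)) = 0"
    using c(3) by simp
  then have "s * (\<Sum>i\<in>T. c i * (l \<bullet> v i)) = 0"
    by (simp add: inner_sum_right)
  then have "0 = (\<Sum>i\<in>T. (s * c i) * (l \<bullet> v i))"
    by (simp add: sum_distrib_left mult.assoc)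
  also have "\<dots> = (\<Sum>u\<in>U. (s * c u) * (l \<bullet> v u)) + (\<Sum>u\<in>Suc ` U. (s * c u) * (l \<bullet> v u))"
    unfolding T_def using fin disj by (intro sum.union_disjoint) auto
  also have "\<dots> > 0"
  proof (rule add_pos_nonneg)
    show "0 < (\<Sum>u\<in>U. (s * c u) * (l \<bullet> v u))"
      using fin posU pos U by (intro sum_pos) auto
    show "0 \<le> (\<Sum>u\<in>Suc ` U. (s * c u) * (l \<bullet> v u))"
    proof (rule sum_nonneg)
      fix t assume "t \<in> Suc ` U"
      then obtain u where u: "u \<in> U" "t = Suc u" by auto
      show "0 \<le> (s * c t) * (l \<bullet> v t)"
        using negU[OF u(1)] next_nonpos[OF u(1)] unfolding u(2)
        by (intro mult_nonpos_nonpos) simp_all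
    qed
  qed
  finally show False by simp
qed

text \<open>Fewer than \<open>m\<close> pairs leave at least
  \<open>3 * m - 1 - 2 * (m - 1) = m + 1\<close> unmatched indices, each followed by an index
  outside the halfspace. Since \<open>n - 1\<close> is not in \<open>W\<close>, these successors are
  genuine and no run wraps around.\<close>

lemma halfspace_contains_facet_aux:
  assumes W: "W = {i. i < n \<and> 0 < l \<bullet> v i}" and card: "3 * m - 1 \<le> card W" and last: "n - 1 \<notin> W"
  shows "\<exists>K \<subseteq> cyclic_blocks n. card K \<le> m \<and> \<Union>K \<subseteq> W \<and> card (\<Union>K) = 2 * m"
proof -
  have "finite W" by (simp add: W)
  obtain M U where MU: "finite M" "finite U" "M \<inter> Suc ` M = {}" "W = M \<union> Suc ` M \<union> U"
    "U \<inter> (M \<union> Suc ` M) = {}" "\<And>u. u \<in> U \<Longrightarrow> Suc u \<notin> W"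
    using obtain_greedy_matching[OF \<open>finite W\<close>] by metis
  have "card W = card (M \<union> Suc ` M) + card U"
    using MU by (subst MU(4), subst card_Un_disjoint) auto
  also have "card (M \<union> Suc ` M) = 2 * card M"
    using MU by (subst card_Un_disjoint) (auto simp: card_image)
  finally have cardW: "card W = 2 * card M + card U" .
  show ?thesis
  proof (cases "m \<le> card M")
    case True
    then obtain M' where M': "M' \<subseteq> M" "card M' = m" "finite M'"
      using obtain_subset_with_card_n by metis
    define K where "K = (\<lambda>i. {i, Suc i}) ` M'"
    have "Suc i < n" if "i \<in> M" for i
      using that MU(4) W by blast
    then have "K \<subseteq> cyclic_blocks n"
      using M'(1) by (force simp: K_def cyclic_blocks_def)
    moreover have "card K \<le> m"
      using card_image_le[of M' "\<lambda>i. {i, Suc i}"] M' by (simp add: K_def)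
    moreover have UK: "\<Union>K = M' \<union> Suc ` M'"
      by (auto simp: K_def)
    moreover have "\<Union>K \<subseteq> W"
      using UK M'(1) MU(4) by blast
    moreover have "M' \<inter> Suc ` M' = {}"
      using M'(1) MU(3) by blast
    then have "card (\<Union>K) = 2 * m"
      using M' by (simp add: UK card_Un_disjoint card_image)
    ultimately show ?thesis by blast
  next
    case False
    then have "m + 1 \<le> card U"
      using cardW card m by linarith
    then obtain U' where U': "U' \<subseteq> U" "card U' = m + 1"
      using obtain_subset_with_card_n by metis
    have False
    proof (rule no_alternating_halfspace)
      show "U' \<subseteq> {..<n}"
        using U' MU(4) W by blast
      fix u assume "u \<in> U'"
      then have u: "u \<in> W" "Suc u \<notin> W"
        using U' MU(4,6) by auto
      then show "0 < l \<bullet> v u" using W by simp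
      have "u \<noteq> n - 1" "u < n"
        using u last W by auto
      then have "Suc u < n" by simp
      then show "Suc u < n \<and> l \<bullet> v (Suc u) \<le> 0"
        using u W by auto
    qed (rule U'(2))
    then show ?thesis ..
  qed
qed

lemma rotate_block:
  assumes "B \<in> cyclic_blocks n"
  shows "(\<lambda>i. (i + j) mod n) ` B \<in> cyclic_blocks n"
proof -
  have n0: "0 < n" using n m by simp
  consider i where "i < n" "B = {i}" | i where "i < n" "B = {i, Suc i mod n}"
    using assms by (auto simp: cyclic_blocks_def)
  then show ?thesis
  proof cases
    case 1
    then show ?thesis using n0 by (simp add: cyclic_blocks_def)
  next
    case 2
    have "(Suc i mod n + j) mod n = Suc ((i + j) mod n) mod n"
      by (simp add: mod_simps)
    then show ?thesis
      using 2 n0 by (auto simp: cyclic_blocks_def intro!: image_eqI[of _ _ "(i + j) mod n"])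
  qed
qed

lemma inj_on_rotation: "inj_on (\<lambda>i. (i + j) mod n) {..<n}"
proof (rule inj_onI)
  fix x y assume *: "x \<in> {..<n}" "y \<in> {..<n}" "(x + j) mod n = (y + j) mod n"
  have inv: "((z + j) mod n + (n - j mod n)) mod n = z" if "z < n" for z
  proof -
    have "j mod n \<le> n" using that by (simp add: less_imp_le)
    then have "z + j + (n - j mod n) = z + n * Suc (j div n)"
      using mult_div_mod_eq[of n j] unfolding mult_Suc_right by linarith
    then have "(z + j + (n - j mod n)) mod n = z"
      using that by (metis mod_less mod_mult_self2)
    then show ?thesis by (metis mod_add_left_eq)
  qed
  show "x = y" using * inv[of x] inv[of y] by simp
qed

text \<open>The block joining \<open>n - 1\<close> to 0 makes the hypothesis on faces cyclically
  symmetric, although the parameters on the moment curve are ordered linearly.\<close>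

lemma cyclic_configuration_rotate: "cyclic_configuration m n (\<lambda>i. v ((i + j) mod n))"
proof
  fix K assume K: "K \<subseteq> cyclic_blocks n" "card K \<le> m"
  let ?r = "\<lambda>i. (i + j) mod n"
  have n0: "0 < n" using n m by simp
  have "image ?r ` K \<subseteq> cyclic_blocks n"
    using rotate_block K by blast
  moreover have "card (image ?r ` K) \<le> m"
    using card_image_le[of K "image ?r"] K finite_subset[OF K(1)] by simp
  ultimately obtain g where g: "\<forall>i<n. if i \<in> \<Union>(image ?r ` K) then g \<bullet> v i = 0 else g \<bullet> v i < 0"
    using support by blast
  have iff: "?r i \<in> \<Union>(image ?r ` K) \<longleftrightarrow> i \<in> \<Union>K" if "i < n" for i
  proof
    assume "?r i \<in> \<Union>(image ?r ` K)"
    then obtain k where k: "k \<in> \<Union>K" "?r i = ?r k" by auto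
    then have "k < n"
      using Union_cyclic_blocks_subset[OF K(1)] by auto
    then have "i = k"
      using inj_onD[OF inj_on_rotation k(2)] that by auto
    then show "i \<in> \<Union>K" using k by simp
  qed auto
  show "\<exists>g. \<forall>i<n. if i \<in> \<Union>K then g \<bullet> v (?r i) = 0 else g \<bullet> v (?r i) < 0"
    using g n0 iff by (metis mod_less_divisor)
qed (use dim n m in auto)

text \<open>Rotating the indices moves a vertex outside the halfspace to the last position.\<close>

proposition halfspace_contains_facet:
  assumes card: "3 * m - 1 \<le> card {i. i < n \<and> 0 < l \<bullet> v i}"
  shows "\<exists>K \<subseteq> cyclic_blocks n. card K \<le> m \<and> (\<forall>i\<in>\<Union>K. 0 < l \<bullet> v i) \<and> card (\<Union>K) = 2 * m"
proof (cases "\<forall>i<n. 0 < l \<bullet> v i")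
  case True
  \<comment> \<open>No outside vertex is available for the last position here, but every facet
    qualifies; the first \<open>m\<close> disjoint pairs give one.\<close>
  define K where "K = (\<lambda>i. {2 * i, Suc (2 * i)}) ` {..<m}"
  have "K \<subseteq> cyclic_blocks n"
  proof
    fix B assume "B \<in> K"
    then obtain i where i: "i < m" "B = {2 * i, Suc (2 * i)}" by (auto simp: K_def)
    then have "Suc (2 * i) < n" using n by simp
    then show "B \<in> cyclic_blocks n"
      using i by (auto simp: cyclic_blocks_def intro!: image_eqI[of _ _ "2 * i"])
  qed
  moreover have "card K \<le> m"
    using card_image_le[of "{..<m}" "\<lambda>i. {2 * i, Suc (2 * i)}"] by (simp add: K_def)
  moreover have "\<Union>K = {..<2 * m}"
  proof (intro equalityI subsetI)
    fix i assume "i \<in> {..<2 * m}"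
    then have "i div 2 < m" "i = 2 * (i div 2) \<or> i = Suc (2 * (i div 2))" by auto
    then show "i \<in> \<Union>K" unfolding K_def by blast
  qed (auto simp: K_def)
  ultimately show ?thesis
    using True n by (intro exI[of _ K]) auto
next
  case False
  then obtain j where j: "j < n" "\<not> 0 < l \<bullet> v j" by auto
  \<comment> \<open>The shift by \<open>Suc j\<close> sends the last index \<open>n - 1\<close> to
    \<open>j\<close>.\<close>
  let ?r = "\<lambda>i. (i + Suc j) mod n"
  interpret rot: cyclic_configuration m n "\<lambda>i. v (?r i)"
    by (rule cyclic_configuration_rotate)
  have n0: "0 < n" using n m by simp
  have bij: "bij_betw ?r {..<n} {..<n}"
    unfolding bij_betw_def using n0
    by (intro conjI inj_on_rotation endo_inj_surj) auto
  let ?W = "{i. i < n \<and> 0 < l \<bullet> v (?r i)}"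
  have rW: "?r ` ?W = {i. i < n \<and> 0 < l \<bullet> v i}"
    using bij by (auto simp: bij_betw_def image_iff)
  have "card (?r ` ?W) = card ?W"
    by (intro card_image inj_on_subset[OF inj_on_rotation]) auto
  moreover have "?r (n - 1) = j"
    using n0 j by simp
  ultimately obtain K where K: "K \<subseteq> cyclic_blocks n" "card K \<le> m" "\<Union>K \<subseteq> ?W" "card (\<Union>K) = 2 * m"
    using rot.halfspace_contains_facet_aux[OF refl, of l] card rW j by auto
  have "\<Union>(image ?r ` K) = ?r ` \<Union>K" by auto
  moreover have "card (?r ` \<Union>K) = card (\<Union>K)"
    using K(3) by (intro card_image inj_on_subset[OF inj_on_rotation]) auto
  moreover have "card (image ?r ` K) \<le> m"
    using card_image_le[of K "image ?r"] K finite_subset[OF K(1)] by simp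
  moreover have "image ?r ` K \<subseteq> cyclic_blocks n"
    using rotate_block K by blast
  moreover have "\<forall>i\<in>?r ` \<Union>K. 0 < l \<bullet> v i"
    using K(3) by blast
  ultimately show ?thesis
    using K(4) by (intro exI[of _ "image ?r ` K"]) simp
qed

end

section \<open>Faces of cyclic polytopes\<close>

text \<open>The moment curve starts with \<open>t\<close>, not with 1, so the constant coefficient
  cannot be absorbed into \<open>a\<close>; it becomes the offset of a hyperplane.\<close>

lemma linear_functional_of_poly:
  fixes p :: "real poly"
  assumes "degree p \<le> CARD('d)"
  obtains a :: "real ^ 'd" where "\<And>t. a \<bullet> moment_curve t = poly p t - coeff p 0"
proof
  define e where "e = to_nat_on (UNIV :: 'd set)"
  have bij: "bij_betw e UNIV {..<CARD('d)}"
    unfolding e_def by (rule to_nat_on_finite) simp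
  fix t :: real
  have "(\<chi> i. coeff p (Suc (e i))) \<bullet> (moment_curve t :: real ^ 'd) =
      (\<Sum>i\<in>UNIV. coeff p (Suc (e i)) * t ^ Suc (e i))"
    by (simp add: inner_vec_def moment_curve_def e_def)
  also have "\<dots> = (\<Sum>k<CARD('d). coeff p (Suc k) * t ^ Suc k)"
    by (rule sum.reindex_bij_betw[OF bij])
  also have "\<dots> = (\<Sum>k<Suc CARD('d). coeff p k * t ^ k) - coeff p 0"
    by (subst sum.lessThan_Suc_shift) simp
  also have "(\<Sum>k<Suc CARD('d). coeff p k * t ^ k) = (\<Sum>k\<le>degree p. coeff p k * t ^ k)"
    using assms by (intro sum.mono_neutral_right) (auto simp: coeff_eq_0)
  also have "\<dots> = poly p t"
    by (simp add: poly_altdef)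
  finally show "(\<chi> i. coeff p (Suc (e i))) \<bullet> (moment_curve t :: real ^ 'd) = poly p t - coeff p 0" .
qed

text \<open>A singleton gives a double root; two neighbours give simple roots with no parameter
  between them; for the wrap-around pair the roots are the extreme parameters, and leading
  coefficient -1 makes the polynomial positive in between.\<close>

lemma block_polynomial:
  fixes s :: "nat \<Rightarrow> real"
  assumes mono: "\<And>i j. i < j \<Longrightarrow> j < n \<Longrightarrow> s i < s j" and B: "B \<in> cyclic_blocks n"
  shows "\<exists>p. degree p \<le> 2 \<and> (\<forall>j<n. if j \<in> B then poly p (s j) = 0 else 0 < poly p (s j))"
proof -
  have neq: "s i \<noteq> s j" if "i \<noteq> j" "i < n" "j < n" for i j
    using mono[of i j] mono[of j i] that by (auto simp: neq_iff)
  consider i where "i < n" "B = {i}" | i where "Suc i < n" "B = {i, Suc i}"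
    | "n \<noteq> 0" "B = {n - 1, 0}"
  proof -
    obtain i where i: "i < n" "B = {i} \<or> B = {i, Suc i mod n}"
      using B by (auto simp: cyclic_blocks_def)
    show ?thesis
    proof (cases "Suc i < n")
      case True
      then show ?thesis using i that by auto
    next
      case False
      then have "Suc i = n" using i by simp
      then show ?thesis using i that by auto
    qed
  qed
  then show ?thesis
  proof cases
    case 1
    show ?thesis
    proof (intro exI conjI allI impI)
      show "degree ([:- s i, 1:] * [:- s i, 1:]) \<le> 2"
        by (rule order.trans[OF degree_mult_le]) simp
      fix j assume "j < n"
      moreover have "poly ([:- s i, 1:] * [:- s i, 1:]) (s j) = (s j - s i)\<^sup>2"
        by (simp add: power2_eq_square algebra_simps)
      ultimately show "if j \<in> B then poly ([:- s i, 1:] * [:- s i, 1:]) (s j) = 0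
          else 0 < poly ([:- s i, 1:] * [:- s i, 1:]) (s j)"
        using 1 neq[of j i] by auto
    qed
  next
    case 2
    show ?thesis
    proof (intro exI conjI allI impI)
      show "degree ([:- s i, 1:] * [:- s (Suc i), 1:]) \<le> 2"
        by (rule order.trans[OF degree_mult_le]) simp
      fix j assume j: "j < n"
      have eq: "poly ([:- s i, 1:] * [:- s (Suc i), 1:]) (s j) = (s j - s i) * (s j - s (Suc i))"
        by (simp add: algebra_simps)
      have "0 < (s j - s i) * (s j - s (Suc i))" if "j \<noteq> i" "j \<noteq> Suc i"
      proof (cases "j < i")
        case True
        then show ?thesis
          using 2(1) mono[of j i] mono[of j "Suc i"] by (intro mult_neg_neg) auto
      next
        case False
        then show ?thesis
          using j that mono[of i j] mono[of "Suc i" j] by (intro mult_pos_pos) auto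
      qed
      then show "if j \<in> B then poly ([:- s i, 1:] * [:- s (Suc i), 1:]) (s j) = 0
          else 0 < poly ([:- s i, 1:] * [:- s (Suc i), 1:]) (s j)"
        unfolding eq using 2(2) by auto
    qed
  next
    case 3
    show ?thesis
    proof (intro exI conjI allI impI)
      show "degree ([:s (n - 1), -1:] * [:- s 0, 1:]) \<le> 2"
        by (rule order.trans[OF degree_mult_le]) simp
      fix j assume j: "j < n"
      have eq: "poly ([:s (n - 1), -1:] * [:- s 0, 1:]) (s j) = (s (n - 1) - s j) * (s j - s 0)"
        by (simp add: algebra_simps)
      have "0 < (s (n - 1) - s j) * (s j - s 0)" if "j \<noteq> n - 1" "j \<noteq> 0"
        using j that mono[of 0 j] mono[of j "n - 1"] by (intro mult_pos_pos) auto
      then show "if j \<in> B then poly ([:s (n - 1), -1:] * [:- s 0, 1:]) (s j) = 0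
          else 0 < poly ([:s (n - 1), -1:] * [:- s 0, 1:]) (s j)"
        unfolding eq using 3(2) by auto
    qed
  qed
qed

text \<open>By Krein-Milman, \<open>F\<close> is the hull of its extreme points, and these are
  extreme in the whole hull, hence in \<open>X\<close>.\<close>

lemma face_with_unique_vertex:
  fixes X :: "'a::euclidean_space set"
  assumes "finite X" "F face_of convex hull X" "F \<inter> X = {y}"
  shows "F = {y}"
proof -
  have "compact (convex hull X)"
    using assms(1) by (simp add: finite_imp_compact_convex_hull)
  then have "compact F" "convex F"
    using assms(2) face_of_imp_compact face_of_imp_convex convex_convex_hull by blast+
  then have F: "F = convex hull {z. z extreme_point_of F}"
    by (rule Krein_Milman_Minkowski)
  define E where "E = {z. z extreme_point_of F}"
  have "E \<subseteq> {y}"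
    using assms extreme_point_of_face[OF assms(2)] extreme_point_of_convex_hull
    unfolding E_def by blast
  moreover have FE: "F = convex hull E"
    using F unfolding E_def .
  then have "E \<noteq> {}"
    using assms(3) by auto
  ultimately have "E = {y}" by blast
  then show ?thesis using FE by simp
qed

text \<open>The sufficient half of Gale's evenness condition: degree at most \<open>CARD('d)\<close>
  makes a polynomial along the curve the restriction of an affine functional.\<close>

proposition cyclic_polytope_faces:
  fixes Q :: "(real ^ 'd) set"
  assumes Q: "cyclic_polytope n Q" and dim: "CARD('d) = 2 * m"
  obtains x where "Q = convex hull (x ` {..<n})"
    "\<And>K. K \<subseteq> cyclic_blocks n \<Longrightarrow> card K \<le> m \<Longrightarrow>
      \<exists>F. F face_of Q \<and> (\<forall>i<n. x i \<in> F \<longleftrightarrow> i \<in> \<Union>K)"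
    "\<And>i. i < n \<Longrightarrow> {x i} face_of Q"
proof -
  obtain t where t: "strict_mono_on {1..n} t" "Q = convex hull ((\<lambda>i. moment_curve (t i)) ` {1..n})"
    using Q by (auto simp: cyclic_polytope_def)
  \<comment> \<open>The definition of the polytope counts from 1, the blocks from 0.\<close>
  define s where "s = (\<lambda>i. t (Suc i))"
  define x where "x = (\<lambda>i. moment_curve (s i) :: real ^ 'd)"
  have mono: "s i < s j" if "i < j" "j < n" for i j
    using strict_mono_onD[OF t(1), of "Suc i" "Suc j"] that by (simp add: s_def)
  have "{1..n} = Suc ` {..<n}"
    by (simp add: image_Suc_lessThan)
  then have Qx: "Q = convex hull (x ` {..<n})"
    using t(2) by (simp add: x_def s_def image_image)
  have faces: "\<exists>F. F face_of Q \<and> (\<forall>i<n. x i \<in> F \<longleftrightarrow> i \<in> \<Union>K)"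
    if K: "K \<subseteq> cyclic_blocks n" "card K \<le> m" for K
  proof -
    have finK: "finite K" using K finite_subset finite_cyclic_blocks by blast
    have "\<forall>B\<in>K. \<exists>p. degree p \<le> 2 \<and> (\<forall>j<n. if j \<in> B then poly p (s j) = 0 else 0 < poly p (s j))"
      using K block_polynomial[of n s] mono by blast
    then obtain h where h: "\<And>B. B \<in> K \<Longrightarrow> degree (h B) \<le> 2"
        "\<And>B j. B \<in> K \<Longrightarrow> j < n \<Longrightarrow> if j \<in> B then poly (h B) (s j) = 0 else 0 < poly (h B) (s j)"
      by metis
    define p where "p = prod h K"
    have "degree p \<le> (\<Sum>B\<in>K. 2)"
      unfolding p_def using h(1) by (intro order.trans[OF degree_prod_sum_le[OF finK]] sum_mono) simp
    then have "degree p \<le> CARD('d)"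
      using K dim by simp
    then obtain a :: "real ^ 'd" where a: "\<And>t. a \<bullet> moment_curve t = poly p t - coeff p 0"
      using linear_functional_of_poly by metis
    have p0: "poly p (s j) = 0" if "j < n" "j \<in> \<Union>K" for j
      using that h(2) finK by (fastforce simp: p_def poly_prod)
    have ppos: "0 < poly p (s j)" if "j < n" "j \<notin> \<Union>K" for j
      using that h(2) unfolding p_def poly_prod by (intro prod_pos) (metis UnionI)
    let ?F = "Q \<inter> {y. a \<bullet> y = - coeff p 0}"
    have "Q \<subseteq> {y. - coeff p 0 \<le> a \<bullet> y}"
      unfolding Qx
    proof (rule hull_minimal)
      show "x ` {..<n} \<subseteq> {y. - coeff p 0 \<le> a \<bullet> y}"
        using p0 ppos by (auto simp: x_def a) (metis less_eq_real_def)
    qed (simp add: convex_halfspace_ge)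
    then have "?F face_of Q"
      using Qx by (intro face_of_Int_supporting_hyperplane_ge) auto
    moreover have "x i \<in> ?F \<longleftrightarrow> i \<in> \<Union>K" if "i < n" for i
    proof -
      have "x i \<in> Q" unfolding Qx using that by (intro hull_inc) simp
      moreover have "a \<bullet> x i = - coeff p 0 \<longleftrightarrow> poly p (s i) = 0"
        by (simp add: x_def a)
      ultimately show ?thesis
        using p0[OF that] ppos[OF that] by (cases "i \<in> \<Union>K") auto
    qed
    ultimately show ?thesis by blast
  qed
  have m: "1 \<le> m"
    using dim zero_less_card_finite[where 'a='d] by linarith
  have single: "\<exists>F. F face_of Q \<and> (\<forall>j<n. x j \<in> F \<longleftrightarrow> j = i)" if "i < n" for i
    using faces[of "{{i}}"] that m by (auto simp: cyclic_blocks_def)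
  have vertex: "{x i} face_of Q" if "i < n" for i
  proof -
    obtain F where F: "F face_of Q" "\<forall>j<n. x j \<in> F \<longleftrightarrow> j = i"
      using single[OF \<open>i < n\<close>] by blast
    have "F \<inter> x ` {..<n} = {x i}"
      using F(2) that by auto
    then have "F = {x i}"
      using face_with_unique_vertex[of "x ` {..<n}" F] F(1) Qx by auto
    then show ?thesis using F(1) by simp
  qed
  show ?thesis
    using that[OF Qx faces vertex] by blast
qed

section \<open>Spherical realizations\<close>

lemma cone_over_halfspaces:
  fixes A :: "'a::euclidean_space set"
  assumes P: "P = {x \<in> sphere 0 1. \<forall>a\<in>A. a \<bullet> x \<le> 0}"
  shows "cone_over P = {x. \<forall>a\<in>A. a \<bullet> x \<le> 0}"
proof (intro equalityI subsetI)
  fix x assume "x \<in> cone_over P"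
  then show "x \<in> {x. \<forall>a\<in>A. a \<bullet> x \<le> 0}"
    by (auto simp: cone_over_def cone_hull_expl P mult_nonneg_nonpos)
next
  fix x assume x: "x \<in> {x. \<forall>a\<in>A. a \<bullet> x \<le> 0}"
  show "x \<in> cone_over P"
  proof (cases "x = 0")
    case False
    then have "x /\<^sub>R norm x \<in> P"
      using x by (auto simp: P divide_nonpos_nonneg inverse_eq_divide mult_nonneg_nonpos)
    moreover have "x = norm x *\<^sub>R (x /\<^sub>R norm x)"
      using False by simp
    ultimately show ?thesis
      unfolding cone_over_def cone_hull_expl by (metis (mono_tags, lifting) insertCI mem_Collect_eq norm_ge_zero)
  qed (simp add: cone_over_def)
qed

definition nonneg_span :: "nat \<Rightarrow> (nat \<Rightarrow> 'a::real_vector) \<Rightarrow> 'a set" where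
  "nonneg_span n v = {\<Sum>i<n. c i *\<^sub>R v i | c. \<forall>i<n. 0 \<le> c i}"

lemma convex_nonneg_span: "convex (nonneg_span n v)"
proof (rule convexI)
  fix x y :: 'a and a b :: real
  assume xy: "x \<in> nonneg_span n v" "y \<in> nonneg_span n v" and ab: "0 \<le> a" "0 \<le> b"
  obtain c d where "x = (\<Sum>i<n. c i *\<^sub>R v i)" "\<forall>i<n. 0 \<le> c i" "y = (\<Sum>i<n. d i *\<^sub>R v i)" "\<forall>i<n. 0 \<le> d i"
    using xy by (auto simp: nonneg_span_def)
  then have "a *\<^sub>R x + b *\<^sub>R y = (\<Sum>i<n. (a * c i + b * d i) *\<^sub>R v i)" "\<forall>i<n. 0 \<le> a * c i + b * d i"
    using ab by (auto simp: scaleR_sum_right sum.distrib scaleR_add_left)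
  then show "a *\<^sub>R x + b *\<^sub>R y \<in> nonneg_span n v"
    unfolding nonneg_span_def by (intro CollectI exI[of _ "\<lambda>i. a * c i + b * d i"] conjI)
qed

lemma nonneg_span_scaleR: "x \<in> nonneg_span n v \<Longrightarrow> 0 \<le> a \<Longrightarrow> a *\<^sub>R x \<in> nonneg_span n v"
  unfolding nonneg_span_def
proof clarify
  fix c :: "nat \<Rightarrow> real" assume "\<forall>i<n. 0 \<le> c i" "0 \<le> a"
  then show "\<exists>c'. a *\<^sub>R (\<Sum>i<n. c i *\<^sub>R v i) = (\<Sum>i<n. c' i *\<^sub>R v i) \<and> (\<forall>i<n. 0 \<le> c' i)"
    by (intro exI[of _ "\<lambda>i. a * c i"]) (simp add: scaleR_sum_right)
qed

lemma nonneg_span_base: "i < n \<Longrightarrow> v i \<in> nonneg_span n v"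
  unfolding nonneg_span_def
  by (rule CollectI, rule exI[of _ "\<lambda>j. if j = i then 1 else 0"])
    (simp add: if_distrib[of "\<lambda>a. a *\<^sub>R _"] cong: if_cong)

lemma nonneg_span_0: "0 \<in> nonneg_span n v"
  unfolding nonneg_span_def by (rule CollectI, rule exI[of _ "\<lambda>_. 0"]) simp

text \<open>Minus the sum of the normals is nonnegative on \<open>K\<close>, and where it vanishes
  all inequalities are tight, so that \<open>- x\<close> is in \<open>K\<close> too. On the unit
  vectors of \<open>K\<close>, if any, it has a positive minimum, whose inverse bounds the
  slice.\<close>

lemma pointed_cone_slice:
  fixes K :: "'a::euclidean_space set"
  assumes A: "finite A" "K = {x. \<forall>a\<in>A. a \<bullet> x \<le> 0}" and pointed: "\<And>x. x \<in> K \<Longrightarrow> - x \<in> K \<Longrightarrow> x = 0"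
  obtains u where "\<And>x. x \<in> K \<Longrightarrow> x \<noteq> 0 \<Longrightarrow> 0 < u \<bullet> x" "compact (K \<inter> {x. u \<bullet> x = 1})"
proof
  define u where "u = - (\<Sum>a\<in>A. a)"
  have ux: "u \<bullet> x = (\<Sum>a\<in>A. - (a \<bullet> x))" for x
    by (simp add: u_def inner_sum_left sum_negf)
  show pos: "0 < u \<bullet> x" if "x \<in> K" "x \<noteq> 0" for x
  proof (rule ccontr)
    assume "\<not> 0 < u \<bullet> x"
    moreover have "0 \<le> u \<bullet> x"
      unfolding ux using that(1) A(2) by (intro sum_nonneg) auto
    ultimately have "(\<Sum>a\<in>A. - (a \<bullet> x)) = 0"
      unfolding ux by simp
    then have "\<forall>a\<in>A. - (a \<bullet> x) = 0"
      using that(1) A by (subst (asm) sum_nonneg_eq_0_iff) auto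
    then have "- x \<in> K"
      using A(2) by auto
    then show False using pointed that by blast
  qed
  have "K = (\<Inter>a\<in>A. {x. a \<bullet> x \<le> 0})"
    using A(2) by auto
  then have cl: "closed K"
    by (auto intro!: closed_INT closed_halfspace_le)
  have scale: "c *\<^sub>R x \<in> K" if "x \<in> K" "0 \<le> c" for c x
    using that A(2) by (auto simp: mult_nonneg_nonpos)
  have "bounded (K \<inter> {x. u \<bullet> x = 1})"
  proof (cases "K \<inter> sphere 0 1 = {}")
    case True
    have "x = 0" if "x \<in> K" for x
    proof (rule ccontr)
      assume "x \<noteq> 0"
      then have "x /\<^sub>R norm x \<in> K \<inter> sphere 0 1"
        using scale[OF that, of "inverse (norm x)"] by simp
      then show False using True by blast
    qed
    then have "K \<inter> {x. u \<bullet> x = 1} \<subseteq> {0}" by blast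
    then show ?thesis using bounded_subset bounded_insert bounded_empty by metis
  next
    case False
    have "compact (K \<inter> sphere 0 1)"
      using cl by (intro closed_Int_compact) auto
    moreover have "continuous_on (K \<inter> sphere 0 1) (\<lambda>x. u \<bullet> x)"
      by (intro continuous_intros)
    ultimately obtain z where z: "z \<in> K \<inter> sphere 0 1"
        "\<And>y. y \<in> K \<inter> sphere 0 1 \<Longrightarrow> u \<bullet> z \<le> u \<bullet> y"
      using continuous_attains_inf[OF _ False] by blast
    have "z \<noteq> 0" using z(1) by auto
    then have uz: "0 < u \<bullet> z" using pos z(1) by auto
    have "norm x \<le> 1 / (u \<bullet> z)" if "x \<in> K" "u \<bullet> x = 1" for x
    proof -
      have "x \<noteq> 0" using that by auto
      then have "x /\<^sub>R norm x \<in> K \<inter> sphere 0 1"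
        using scale[OF that(1), of "inverse (norm x)"] by simp
      then have "u \<bullet> z \<le> inverse (norm x)"
        using z(2)[of "x /\<^sub>R norm x"] that(2) by simp
      then show ?thesis
        using uz \<open>x \<noteq> 0\<close> by (simp add: field_simps)
    qed
    then show ?thesis
      by (intro boundedI[of _ "1 / (u \<bullet> z)"]) auto
  qed
  then show "compact (K \<inter> {x. u \<bullet> x = 1})"
    using cl by (simp add: compact_eq_bounded_closed closed_hyperplane closed_Int)
qed

text \<open>Atoms of the two face lattices correspond to each other: on the side of \<open>Q\<close> they are the
  vertices, on the side of \<open>P\<close> the points spanning the extreme rays of the cone.\<close>

proposition realization_vectors:
  fixes P :: "'a::euclidean_space set" and x :: "nat \<Rightarrow> 'b::euclidean_space"
  assumes P: "spherical_polytope P" and Q: "Q = convex hull (x ` {..<n})"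
    and vertex: "\<And>i. i < n \<Longrightarrow> {x i} face_of Q"
    and bij: "bij_betw f {F. F face_of Q} (sph_faces P)"
    and iso: "\<And>F G. F face_of Q \<Longrightarrow> G face_of Q \<Longrightarrow> F \<subseteq> G \<longleftrightarrow> f F \<subseteq> f G"
  obtains v where "\<And>i. i < n \<Longrightarrow> norm (v i) = 1" "cone_over P = nonneg_span n v"
    "\<And>F. F face_of Q \<Longrightarrow> \<exists>g. \<forall>i<n. if x i \<in> F then g \<bullet> v i = 0 else g \<bullet> v i < 0"
proof -
  obtain A where A: "finite A" "P = {x \<in> sphere 0 1. \<forall>a\<in>A. a \<bullet> x \<le> 0}" "\<not> (\<exists>x\<in>P. - x \<in> P)"
    using P unfolding spherical_polytope_def by blast
  define K where "K = cone_over P"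
  have K: "K = {x. \<forall>a\<in>A. a \<bullet> x \<le> 0}"
    unfolding K_def by (rule cone_over_halfspaces[OF A(2)])
  have scale: "c *\<^sub>R y \<in> K" if "y \<in> K" "0 \<le> c" for c y
    using that K by (auto simp: mult_nonneg_nonpos)
  have pointed: "y = 0" if "y \<in> K" "- y \<in> K" for y
  proof (rule ccontr)
    assume "y \<noteq> 0"
    then have "y /\<^sub>R norm y \<in> P" "- (y /\<^sub>R norm y) \<in> P"
      using scale[OF that(1), of "inverse (norm y)"] scale[OF that(2), of "inverse (norm y)"] A(2) K
      by auto
    then show False using A(3) by blast
  qed
  obtain u where u: "\<And>y. y \<in> K \<Longrightarrow> y \<noteq> 0 \<Longrightarrow> 0 < u \<bullet> y" and comp: "compact (K \<inter> {y. u \<bullet> y = 1})"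
    using pointed_cone_slice[OF A(1) K pointed] by blast
  \<comment> \<open>A compact slice that meets every ray of the cone: Krein-Milman applies to it,
    and its extreme points stand for the extreme rays.\<close>
  define R where "R = K \<inter> {y. u \<bullet> y = 1}"
  have conicK: "conic K"
    using scale by (auto simp: conic_def)
  have polyK: "polyhedron K"
  proof -
    have "K = \<Inter>((\<lambda>a. {x. a \<bullet> x \<le> 0}) ` A)" using K by auto
    then show ?thesis using A(1) by (auto intro!: polyhedron_Inter polyhedron_halfspace_le)
  qed
  have convK: "convex K" using polyK by (rule polyhedron_imp_convex)
  have polyR: "polyhedron R"
    unfolding R_def using polyK by (simp add: polyhedron_hyperplane)
  have convR: "convex R" using polyR by (rule polyhedron_imp_convex)
  have compR: "compact R" using comp by (simp add: R_def)
  have normalize: "y /\<^sub>R (u \<bullet> y) \<in> R" if "y \<in> K" "y \<noteq> 0" for y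
    using u[OF that] scale[OF that(1), of "inverse (u \<bullet> y)"] by (simp add: R_def)
  have zero_face: "0 \<in> G" if "G face_of K" "G \<noteq> {}" for G
    using face_of_conic[OF conicK that(1)] that(2) by (auto simp: conic_def) (metis scaleR_zero_left order_refl)

  \<comment> \<open>The inequality \<open>h \<bullet> y \<le> b\<close> exposing \<open>w\<close> in
    the slice is homogenized: \<open>h - b *\<^sub>R u\<close> exposes the ray through
    \<open>w\<close> in the cone.\<close>
  have ray: "\<exists>G. G face_of K \<and> G \<inter> sphere 0 1 = {w /\<^sub>R norm w}" if w: "w extreme_point_of R" for w
  proof -
    have wR: "w \<in> K" "u \<bullet> w = 1"
      using w by (auto simp: extreme_point_of_def R_def)
    then have w0: "w \<noteq> 0" by auto
    have "{w} exposed_face_of R"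
      using w polyR by (simp add: exposed_face_of_polyhedron face_of_singleton)
    then obtain h b where h: "R \<subseteq> {y. h \<bullet> y \<le> b}" "{w} = R \<inter> {y. h \<bullet> y = b}"
      by (auto simp: exposed_face_of_def)
    have le: "(h - b *\<^sub>R u) \<bullet> y \<le> 0" and eq: "(h - b *\<^sub>R u) \<bullet> y = 0 \<Longrightarrow> y = (u \<bullet> y) *\<^sub>R w"
      if y: "y \<in> K" "y \<noteq> 0" for y
    proof -
      note yR = normalize[OF y] and uy = u[OF y]
      have hy: "h \<bullet> (y /\<^sub>R (u \<bullet> y)) = (h \<bullet> y) / (u \<bullet> y)"
        by (simp add: inverse_eq_divide)
      have "(h \<bullet> y) / (u \<bullet> y) \<le> b"
        using yR h(1) hy by auto
      then show "(h - b *\<^sub>R u) \<bullet> y \<le> 0"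
        using uy by (simp add: inner_diff_left field_simps)
      show "y = (u \<bullet> y) *\<^sub>R w" if "(h - b *\<^sub>R u) \<bullet> y = 0"
      proof -
        have "(h \<bullet> y) / (u \<bullet> y) = b"
          using that uy by (simp add: inner_diff_left field_simps)
        then have "y /\<^sub>R (u \<bullet> y) \<in> {w}"
          unfolding h(2) using yR hy by auto
        then show ?thesis using uy by auto
      qed
    qed
    let ?G = "K \<inter> {y. (h - b *\<^sub>R u) \<bullet> y = 0}"
    have "?G face_of K"
    proof (rule face_of_Int_supporting_hyperplane_le[OF convK])
      fix y assume "y \<in> K"
      then show "(h - b *\<^sub>R u) \<bullet> y \<le> 0"
        using le[of y] by (cases "y = 0") auto
    qed
    moreover have "?G \<inter> sphere 0 1 = {w /\<^sub>R norm w}"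
    proof (intro equalityI subsetI)
      fix y assume y: "y \<in> ?G \<inter> sphere 0 1"
      then have y0: "y \<noteq> 0" by auto
      then have yw: "y = (u \<bullet> y) *\<^sub>R w" "0 < u \<bullet> y"
        using y eq u by auto
      have "norm y = 1" using y by simp
      then have "(u \<bullet> y) * norm w = 1"
        by (metis yw abs_of_pos norm_scaleR)
      then have "u \<bullet> y = inverse (norm w)"
        using w0 by (simp add: field_simps)
      then show "y \<in> {w /\<^sub>R norm w}"
        using yw(1) by simp
    next
      fix y assume "y \<in> {w /\<^sub>R norm w}"
      moreover have "h \<bullet> w = b" using h(2) by auto
      then have "(h - b *\<^sub>R u) \<bullet> w = 0"
        using wR by (simp add: inner_diff_left)
      ultimately show "y \<in> ?G \<inter> sphere 0 1"
        using scale[OF wR(1), of "inverse (norm w)"] w0 by simp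
    qed
    ultimately show ?thesis by blast
  qed
  have face_im: "f F \<in> sph_faces P" if "F face_of Q" for F
    using bij that by (auto simp: bij_betw_def)
  have face_pre: "\<exists>F. F face_of Q \<and> f F = G \<inter> sphere 0 1" if "G face_of K" for G
  proof -
    have "G \<inter> sphere 0 1 \<in> sph_faces P"
      using that by (auto simp: sph_faces_def K_def)
    also have "sph_faces P = f ` {F. F face_of Q}"
      using bij by (simp only: bij_betw_def)
    finally obtain F where "G \<inter> sphere 0 1 = f F" "F \<in> {F. F face_of Q}"
      by (rule imageE)
    then show ?thesis by (intro exI[of _ F]) simp
  qed
  have f_empty: "f {} = {}"
  proof -
    obtain F where "F face_of Q" "f F = {}"
      using face_pre[of "{}"] by auto
    then show ?thesis using iso[of "{}" F] by auto
  qed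
  have f_nonempty: "f F \<noteq> {}" if "F face_of Q" "F \<noteq> {}" for F
    using iso[OF that(1) empty_face_of] f_empty that by auto
  \<comment> \<open>The image of a vertex contains the unit vector of some extreme ray. This point
    is itself a face, and its preimage is a nonempty face inside \<open>{x i}\<close>, hence all of
    it.\<close>
  have "\<forall>i<n. \<exists>w. norm w = 1 \<and> w \<in> K \<and> f {x i} = {w}"
  proof (intro allI impI)
    fix i assume i: "i < n"
    have fi: "f {x i} \<in> sph_faces P" "f {x i} \<noteq> {}"
      using face_im[OF vertex[OF i]] f_nonempty[OF vertex[OF i]] by auto
    then obtain G where G: "G face_of K" "f {x i} = G \<inter> sphere 0 1"
      by (auto simp: sph_faces_def K_def)
    have conicG: "conic G" by (rule face_of_conic[OF conicK G(1)])
    obtain y where y: "y \<in> G" "y \<noteq> 0"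
      using fi(2) G(2) by fastforce
    have yK: "y \<in> K" using G(1) y(1) face_of_imp_subset by blast
    have "G \<inter> {y. u \<bullet> y = 1} face_of R"
      unfolding R_def using G(1) by (rule face_of_slice) (rule convex_hyperplane)
    moreover have "y /\<^sub>R (u \<bullet> y) \<in> G \<inter> {y. u \<bullet> y = 1}"
      using conicD[OF conicG y(1), of "inverse (u \<bullet> y)"] u[OF yK y(2)] by simp
    ultimately obtain w where w: "w extreme_point_of (G \<inter> {y. u \<bullet> y = 1})"
      using extreme_point_exists_convex face_of_imp_compact[OF convR compR] face_of_imp_convex
      by (metis empty_iff)
    then have wG: "w \<in> G" "u \<bullet> w = 1" by (auto simp: extreme_point_of_def)
    then have w0: "w \<noteq> 0" by auto
    have "w extreme_point_of R"
      using w extreme_point_of_face[OF \<open>G \<inter> {y. u \<bullet> y = 1} face_of R\<close>] by blast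
    then obtain F where F: "F face_of Q" "f F = {w /\<^sub>R norm w}"
      using ray face_pre by metis
    have wn: "w /\<^sub>R norm w \<in> G" "norm (w /\<^sub>R norm w) = 1"
      using conicD[OF conicG wG(1), of "inverse (norm w)"] w0 by auto
    then have "f F \<subseteq> f {x i}"
      using F(2) G(2) by auto
    then have "F \<subseteq> {x i}"
      using iso[OF F(1) vertex[OF i]] by simp
    moreover have "F \<noteq> {}"
      using F(2) f_empty by auto
    ultimately have "F = {x i}" by blast
    then show "\<exists>w. norm w = 1 \<and> w \<in> K \<and> f {x i} = {w}"
      using F(2) wn G(1) face_of_imp_subset by blast
  qed
  then obtain v where v: "\<And>i. i < n \<Longrightarrow> norm (v i) = 1" "\<And>i. i < n \<Longrightarrow> v i \<in> K"
      "\<And>i. i < n \<Longrightarrow> f {x i} = {v i}"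
    by metis
  have compQ: "compact Q" "convex Q"
    using Q by (auto simp: finite_imp_compact_convex_hull)
  \<comment> \<open>Conversely, the face of \<open>Q\<close> that corresponds to an extreme ray
    contains a vertex \<open>x i\<close>, and monotonicity puts \<open>v i\<close> on that
    ray.\<close>
  have extreme: "w \<in> nonneg_span n v" if w: "w extreme_point_of R" for w
  proof -
    obtain G where G: "G face_of K" "G \<inter> sphere 0 1 = {w /\<^sub>R norm w}"
      using ray[OF w] by blast
    obtain F where F: "F face_of Q" "f F = {w /\<^sub>R norm w}"
      using face_pre[OF G(1)] G(2) by auto
    have "F \<noteq> {}" using F(2) f_empty by auto
    then obtain y where y: "y extreme_point_of F"
      using extreme_point_exists_convex[of F] face_of_imp_compact[OF compQ(2,1) F(1)] face_of_imp_convex[OF F(1)]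
      by blast
    then have "y extreme_point_of Q" "y \<in> F"
      using extreme_point_of_face[OF F(1)] by auto
    then obtain i where i: "i < n" "y = x i"
      using extreme_point_of_convex_hull Q by blast
    have "f {x i} \<subseteq> f F"
      using iso[OF vertex[OF i(1)] F(1)] \<open>y \<in> F\<close> i(2) by simp
    then have vi: "v i = w /\<^sub>R norm w"
      using v(3)[OF i(1)] F(2) by simp
    have "w \<noteq> 0" using w by (auto simp: extreme_point_of_def R_def)
    then have "w = norm w *\<^sub>R v i"
      using vi by simp
    then show ?thesis
      using nonneg_span_scaleR[OF nonneg_span_base[OF i(1)], of "norm w" v] by simp
  qed
  have span: "K = nonneg_span n v"
  proof (intro equalityI subsetI)
    fix y assume y: "y \<in> K"
    show "y \<in> nonneg_span n v"
    proof (cases "y = 0")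
      case False
      have "R \<subseteq> nonneg_span n v"
        using Krein_Milman_Minkowski[OF compR convR] extreme convex_nonneg_span
          hull_minimal[of "{w. w extreme_point_of R}" "nonneg_span n v" convex]
        by blast
      then have "y /\<^sub>R (u \<bullet> y) \<in> nonneg_span n v"
        using normalize[OF y False] by blast
      then have "(u \<bullet> y) *\<^sub>R (y /\<^sub>R (u \<bullet> y)) \<in> nonneg_span n v"
        by (rule nonneg_span_scaleR) (use u[OF y False] in simp)
      moreover have "(u \<bullet> y) *\<^sub>R (y /\<^sub>R (u \<bullet> y)) = y"
        using u[OF y False] by simp
      ultimately show ?thesis by (simp only:)
    qed (simp add: nonneg_span_0)
  next
    fix y assume "y \<in> nonneg_span n v"
    then obtain c where c: "y = (\<Sum>i<n. c i *\<^sub>R v i)" "\<forall>i<n. 0 \<le> c i"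
      by (auto simp: nonneg_span_def)
    show "y \<in> K"
      unfolding K c(1)
    proof (intro CollectI ballI)
      fix a assume "a \<in> A"
      then have "c i * (a \<bullet> v i) \<le> 0" if "i < n" for i
        using v(2)[OF that] c(2) that K by (auto intro: mult_nonneg_nonpos)
      then show "a \<bullet> (\<Sum>i<n. c i *\<^sub>R v i) \<le> 0"
        by (auto simp: inner_sum_right intro!: sum_nonpos)
    qed
  qed
  have supp: "\<exists>g. \<forall>i<n. if x i \<in> F then g \<bullet> v i = 0 else g \<bullet> v i < 0" if F: "F face_of Q" for F
  proof (cases "F = {}")
    case True
    have "- u \<bullet> v i < 0" if "i < n" for i
    proof -
      have "v i \<noteq> 0" using v(1)[OF that] by auto
      then show ?thesis using u[OF v(2)[OF that]] by simp
    qed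
    then show ?thesis using True by (intro exI[of _ "- u"]) simp
  next
    case False
    obtain G where G: "G face_of K" "f F = G \<inter> sphere 0 1"
      using face_im[OF F] by (auto simp: sph_faces_def K_def)
    have mem: "v i \<in> G \<longleftrightarrow> x i \<in> F" if "i < n" for i
      using iso[OF vertex[OF that] F] v(1,3)[OF that] G(2) by auto
    have "G exposed_face_of K"
      using G(1) exposed_face_of_polyhedron[OF polyK] by blast
    then obtain g b where g: "K \<subseteq> {y. g \<bullet> y \<le> b}" "G = K \<inter> {y. g \<bullet> y = b}"
      unfolding exposed_face_of_def by blast
    \<comment> \<open>A nonempty face of the cone contains the apex, so its supporting hyperplane
      passes through 0.\<close>
    have "G \<noteq> {}" using f_nonempty[OF F False] G(2) by auto
    then have "b = 0" using zero_face[OF G(1)] g(2) by auto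
    show ?thesis
    proof (intro exI[of _ g] allI impI)
      fix i assume i: "i < n"
      show "if x i \<in> F then g \<bullet> v i = 0 else g \<bullet> v i < 0"
        using mem[OF i] v(2)[OF i] g \<open>b = 0\<close> by (auto simp: less_le)
    qed
  qed
  show ?thesis
    using that[OF v(1) _ supp] span K_def by blast
qed

section \<open>Caps visible from the vertices\<close>

text \<open>The light cone over the unit sphere of \<open>'b\<close> consists of the multiples of \<open>(1, z)\<close> with \<open>norm z = 1\<close>;
  the tangent hyperplane of the ball at that point has the normal \<open>(-1, z)\<close>. So \<open>visible_cap w\<close>
  is the part of the sphere that is visible from \<open>w\<close>.\<close>

definition visible_cap :: "real \<times> 'b::euclidean_space \<Rightarrow> 'b set" where
  "visible_cap w = {z \<in> sphere 0 1. fst w \<le> z \<bullet> snd w}"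

lemma visible_cap_normalized:
  assumes "snd w \<noteq> 0"
  shows "visible_cap w = {z \<in> sphere 0 1. fst w / norm (snd w) \<le> (snd w /\<^sub>R norm (snd w)) \<bullet> z}"
  using assms by (auto simp: visible_cap_def field_simps inner_commute)

text \<open>The hypothesis says that \<open>w\<close> lies neither in the solid light cone nor in
  its negative; exactly then the height of the cap is strictly between -1 and 1.\<close>

lemma spherical_cap_visible_cap:
  assumes "\<bar>fst w\<bar> < norm (snd w)"
  shows "spherical_cap (visible_cap w)"
proof -
  have "0 < norm (snd w)" using assms by linarith
  then show ?thesis
    unfolding spherical_cap_def
    by (intro exI[of _ "snd w /\<^sub>R norm (snd w)"] exI[of _ "fst w / norm (snd w)"] conjI
        visible_cap_normalized) (use assms in \<open>auto simp: field_simps abs_less_iff\<close>)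
qed

text \<open>A point at height exactly \<open>r\<close> is a limit of points outside the cap: move it
  along the great circle through \<open>p\<close>, lowering its height to
  \<open>r - s\<close>.\<close>

lemma cap_interior_strict:
  fixes p x :: "'b::euclidean_space"
  assumes p: "norm p = 1" "-1 < r" "r < 1"
    and x: "x \<in> top_of_set (sphere 0 1) interior_of {z \<in> sphere 0 1. r \<le> p \<bullet> z}"
  shows "r < p \<bullet> x"
proof (rule ccontr)
  assume "\<not> r < p \<bullet> x"
  obtain T where T: "openin (top_of_set (sphere 0 1)) T" "x \<in> T" "T \<subseteq> {z \<in> sphere 0 1. r \<le> p \<bullet> z}"
    using x by (auto simp: interior_of_def)
  obtain U where U: "open U" "T = sphere 0 1 \<inter> U"
    using T(1) by (auto simp: openin_open)
  have nx: "norm x = 1" and px: "p \<bullet> x = r"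
    using T(2,3) \<open>\<not> r < p \<bullet> x\<close> by auto
  have pp: "p \<bullet> p = 1" and xx: "x \<bullet> x = 1"
    using p(1) nx by (simp_all add: norm_eq_1)
  \<comment> \<open>The normalized component of \<open>x\<close> orthogonal to \<open>p\<close>, so
    that \<open>y s\<close> below is a unit vector of height \<open>r - s\<close>.\<close>
  define e where "e = (x - r *\<^sub>R p) /\<^sub>R sqrt (1 - r\<^sup>2)"
  have r2: "0 < 1 - r\<^sup>2"
    using p(2,3) by (simp add: abs_square_less_1[of r] abs_less_iff)
  have "(x - r *\<^sub>R p) \<bullet> (x - r *\<^sub>R p) = 1 - r\<^sup>2"
    using pp xx px by (simp add: inner_diff inner_commute power2_eq_square algebra_simps)
  moreover have "e \<bullet> e = ((x - r *\<^sub>R p) \<bullet> (x - r *\<^sub>R p)) / (sqrt (1 - r\<^sup>2))\<^sup>2"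
    unfolding e_def inner_scaleR_left inner_scaleR_right by (simp add: power2_eq_square divide_inverse del: real_sqrt_mult_self)
  ultimately have ee: "e \<bullet> e = 1"
    using r2 by simp
  have pe: "p \<bullet> e = 0"
    using pp px by (simp add: e_def inner_diff_right)
  define y where "y = (\<lambda>s. (r - s) *\<^sub>R p + sqrt (1 - (r - s)\<^sup>2) *\<^sub>R e)"
  have "y 0 = x"
    using r2 by (simp add: y_def e_def)
  moreover have "(y \<longlongrightarrow> y 0) (at_right 0)"
    unfolding y_def by (intro tendsto_intros)
  ultimately have "\<forall>\<^sub>F s in at_right 0. y s \<in> U"
    using topological_tendstoD[of y x "at_right 0" U] U T(2) by auto
  moreover have "\<forall>\<^sub>F s in at_right (0::real). s < r + 1"
    using p(2) by (intro eventually_at_rightI[of 0 "r + 1"]) auto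
  moreover have "\<forall>\<^sub>F s in at_right (0::real). 0 < s"
    by (simp add: eventually_at_right_less)
  ultimately have "\<forall>\<^sub>F s in at_right 0. y s \<in> U \<and> s < r + 1 \<and> 0 < s"
    by eventually_elim auto
  then obtain s where s: "y s \<in> U" "s < r + 1" "0 < s"
    using eventually_happens[of _ "at_right (0::real)"] by auto
  have "(r - s)\<^sup>2 < 1"
    using s p(3) by (simp add: abs_square_less_1 abs_less_iff)
  then have "y s \<bullet> y s = 1"
    using pp ee pe
    by (simp add: y_def inner_add inner_commute[of e p] power2_eq_square[symmetric])
  then have "y s \<in> T"
    using s U(2) by (simp add: norm_eq_1)
  moreover have "p \<bullet> y s = r - s"
    using pp pe by (simp add: y_def inner_add_right)
  ultimately show False
    using T(3) s(3) by auto
qed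

text \<open>The strict inequality turns the ply condition at \<open>z\<close> into a count of
  vectors in the open halfspace with normal \<open>(-1, z)\<close>.\<close>

lemma visible_cap_interior:
  fixes w :: "real \<times> 'b::euclidean_space"
  assumes w: "\<bar>fst w\<bar> < norm (snd w)"
  shows "top_of_set (sphere 0 1) interior_of visible_cap w = {z \<in> sphere 0 1. fst w < z \<bullet> snd w}"
proof (intro equalityI subsetI)
  fix z assume z: "z \<in> top_of_set (sphere 0 1) interior_of visible_cap w"
  have pos: "0 < norm (snd w)" using w by linarith
  then have "fst w / norm (snd w) < (snd w /\<^sub>R norm (snd w)) \<bullet> z"
    using z w visible_cap_normalized[of w]
    by (intro cap_interior_strict) (auto simp: field_simps abs_less_iff)
  moreover have "z \<in> sphere 0 1"
    using z interior_of_subset[of "top_of_set (sphere 0 1)" "visible_cap w"] by (auto simp: visible_cap_def)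
  ultimately show "z \<in> {z \<in> sphere 0 1. fst w < z \<bullet> snd w}"
    using pos by (simp add: field_simps inner_commute)
next
  fix z assume z: "z \<in> {z \<in> sphere 0 1. fst w < z \<bullet> snd w}"
  have "{z \<in> sphere 0 1. fst w < z \<bullet> snd w} = sphere 0 1 \<inter> {z. snd w \<bullet> z > fst w}"
    by (auto simp: inner_commute)
  then have "openin (top_of_set (sphere 0 1)) {z \<in> sphere 0 1. fst w < z \<bullet> snd w}"
    using open_halfspace_gt openin_open by blast
  then show "z \<in> top_of_set (sphere 0 1) interior_of visible_cap w"
    using z by (intro subsetD[OF interior_of_maximal]) (auto simp: visible_cap_def)
qed

text \<open>A system of caps is a set, so it has \<open>n\<close> members only if different vertices
  have different caps. Equal caps have equal boundaries; as \<open>q\<close> is constant on the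
  boundary around \<open>p\<close>, it is a multiple of \<open>p\<close>, and then center, height
  and norm agree.\<close>

lemma visible_cap_eqD:
  fixes w w' :: "real \<times> 'b::euclidean_space"
  assumes w: "\<bar>fst w\<bar> < norm (snd w)" "\<bar>fst w'\<bar> < norm (snd w')" and dim: "2 \<le> DIM('b)"
    and eq: "visible_cap w = visible_cap w'" and norms: "norm w = 1" "norm w' = 1"
  shows "w = w'"
proof -
  define p q r s where "p = snd w /\<^sub>R norm (snd w)" and "q = snd w' /\<^sub>R norm (snd w')"
    and "r = fst w / norm (snd w)" and "s = fst w' / norm (snd w')"
  have pos: "0 < norm (snd w)" "0 < norm (snd w')" using w by linarith+
  have w_eq: "w = norm (snd w) *\<^sub>R (r, p)" "w' = norm (snd w') *\<^sub>R (s, q)"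
    using pos by (auto simp: p_def q_def r_def s_def prod_eq_iff)
  have pp: "p \<bullet> p = 1" and qq: "q \<bullet> q = 1"
    using pos by (simp_all add: p_def q_def dot_square_norm power2_eq_square)
  have r: "-1 < r" "r < 1"
    using w(1) pos by (auto simp: r_def field_simps abs_less_iff)
  have r2: "0 < 1 - r\<^sup>2"
    using r by (simp add: abs_square_less_1[of r] abs_less_iff)
  have cap: "r \<le> p \<bullet> z \<longleftrightarrow> s \<le> q \<bullet> z" if "norm z = 1" for z
  proof -
    have "z \<in> visible_cap w \<longleftrightarrow> z \<in> visible_cap w'" using eq by simp
    then show ?thesis
      using that pos unfolding p_def q_def r_def s_def by (subst (asm) (1 2) visible_cap_normalized) auto
  qed
  have boundary: "q \<bullet> z = s" if "norm z = 1" "p \<bullet> z = r" for z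
  proof -
    have "z \<in> visible_cap w" "\<not> fst w < z \<bullet> snd w"
      using that pos by (auto simp: visible_cap_def p_def r_def field_simps inner_commute)
    then have "z \<in> visible_cap w'" "\<not> fst w' < z \<bullet> snd w'"
      using eq visible_cap_interior[OF w(1)] visible_cap_interior[OF w(2)] that(1) by auto
    then show ?thesis
      using pos by (auto simp: visible_cap_def q_def s_def field_simps inner_commute)
  qed
  \<comment> \<open>Compare \<open>q\<close> at two opposite boundary points,
    \<open>r *\<^sub>R p\<close> plus and minus \<open>\<rho> *\<^sub>R e\<close>.\<close>
  have circle: "q \<bullet> e = 0 \<and> r * (q \<bullet> p) = s" if e: "e \<bullet> e = 1" "p \<bullet> e = 0" for e
  proof -
    define \<rho> where "\<rho> = sqrt (1 - r\<^sup>2)"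
    have rho: "0 < \<rho>" "\<rho> * \<rho> = 1 - r\<^sup>2"
      using r2 by (auto simp: \<rho>_def power2_eq_square[symmetric])
    have "q \<bullet> (r *\<^sub>R p + \<rho> *\<^sub>R e) = s"
    proof (rule boundary)
      have "(r *\<^sub>R p + \<rho> *\<^sub>R e) \<bullet> (r *\<^sub>R p + \<rho> *\<^sub>R e) = r * r + \<rho> * \<rho>"
        using e pp by (simp add: inner_add inner_commute[of e p])
      then show "norm (r *\<^sub>R p + \<rho> *\<^sub>R e) = 1"
        using rho by (simp add: norm_eq_1 power2_eq_square)
    qed (use e pp in \<open>simp add: inner_add_right\<close>)
    moreover have "q \<bullet> (r *\<^sub>R p + (- \<rho>) *\<^sub>R e) = s"
    proof (rule boundary)
      have "(r *\<^sub>R p + (- \<rho>) *\<^sub>R e) \<bullet> (r *\<^sub>R p + (- \<rho>) *\<^sub>R e) = r * r + \<rho> * \<rho>"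
        using e pp by (simp add: inner_diff inner_commute[of e p])
      then show "norm (r *\<^sub>R p + (- \<rho>) *\<^sub>R e) = 1"
        using rho by (simp add: norm_eq_1 power2_eq_square)
    qed (use e pp in \<open>simp add: inner_diff_right\<close>)
    ultimately have "r * (q \<bullet> p) + \<rho> * (q \<bullet> e) = s" "r * (q \<bullet> p) - \<rho> * (q \<bullet> e) = s"
      by (simp_all add: inner_add_right inner_diff_right)
    then have "\<rho> * (q \<bullet> e) = 0" "r * (q \<bullet> p) = s" by linarith+
    then show ?thesis using rho by simp
  qed
  have circle': "q \<bullet> e = 0 \<and> r * (q \<bullet> p) = s" if e: "e \<noteq> 0" "p \<bullet> e = 0" for e
    using circle[of "e /\<^sub>R norm e"] e by (simp add: dot_square_norm power2_eq_square)
  obtain e0 where "e0 \<noteq> 0" "orthogonal p e0"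
    using orthogonal_to_vector_exists[OF dim] .
  then have rs: "r * (q \<bullet> p) = s"
    using circle'[of e0] by (simp add: orthogonal_def)
  define e where "e = q - (q \<bullet> p) *\<^sub>R p"
  have pe: "p \<bullet> e = 0"
    using pp by (simp add: e_def inner_diff_right inner_commute)
  have "e = 0"
  proof (rule ccontr)
    assume "e \<noteq> 0"
    then have "q \<bullet> e = 0"
      using circle' pe by simp
    then have "e \<bullet> e = 0"
      using pe by (simp add: e_def inner_diff_left)
    then show False using \<open>e \<noteq> 0\<close> by simp
  qed
  then have q: "q = (q \<bullet> p) *\<^sub>R p"
    by (simp add: e_def)
  then have "(q \<bullet> p) * (q \<bullet> p) = 1"
    using qq by (metis inner_scaleR_right)
  then have "q \<bullet> p = 1 \<or> q \<bullet> p = -1"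
    using square_eq_1_iff by blast
  \<comment> \<open>With opposite centers \<open>s = - r\<close>, and then \<open>p\<close> is in
    the first cap but not in the second, because -1 < - r.\<close>
  moreover have "q \<bullet> p \<noteq> -1"
  proof
    assume "q \<bullet> p = -1"
    moreover have "r \<le> p \<bullet> p" "norm p = 1"
      using r pp by (simp_all add: norm_eq_1)
    ultimately show False
      using cap[of p] rs r by simp
  qed
  ultimately have "q = p" "s = r"
    using q rs by auto
  then have w'_eq: "w' = norm (snd w') *\<^sub>R (r, p)"
    using w_eq(2) by simp
  have "norm (snd w) * norm (r, p) = 1" "norm (snd w') * norm (r, p) = 1"
    using norms w_eq(1) w'_eq pos by (metis abs_norm_cancel norm_scaleR)+
  then have "norm (snd w) = norm (snd w')"
    by (metis mult_cancel_right mult_zero_right zero_neq_one)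
  then show ?thesis
    using w_eq(1) w'_eq by simp
qed

text \<open>After scaling, the normal is \<open>(-1, \<zeta>)\<close> with \<open>\<zeta>\<close> in
  the unit ball, and the two equations put \<open>\<zeta>\<close> on the boundary hyperplanes of
  both caps. From there move orthogonally to \<open>snd w\<close> and \<open>snd w'\<close> until
  the sphere is reached; dimension 3 leaves room for such a direction.\<close>

lemma visible_caps_meet:
  fixes a w w' :: "real \<times> 'b::euclidean_space"
  assumes dim: "3 \<le> DIM('b)" and a: "fst a < 0" "norm (snd a) \<le> - fst a"
    and "a \<bullet> w = 0" "a \<bullet> w' = 0"
  shows "visible_cap w \<inter> visible_cap w' \<noteq> {}"
proof -
  define \<zeta> where "\<zeta> = snd a /\<^sub>R (- fst a)"
  have zeta: "norm \<zeta> \<le> 1" "\<zeta> \<bullet> snd w = fst w" "\<zeta> \<bullet> snd w' = fst w'"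
    using assms by (auto simp: \<zeta>_def inner_prod_def field_simps)
  have "dim {snd w, snd w'} \<le> card {snd w, snd w'}"
    by (rule dim_le_card') simp
  also have "\<dots> < DIM('b)"
    using dim card_insert_le_m1[of 2 "{snd w'}" "snd w"] by simp
  finally obtain e' where e': "e' \<noteq> 0" "\<And>y. y \<in> span {snd w, snd w'} \<Longrightarrow> orthogonal e' y"
    using orthogonal_to_subspace_exists by blast
  define e where "e = e' /\<^sub>R norm e'"
  have e: "e \<bullet> e = 1" "e \<bullet> snd w = 0" "e \<bullet> snd w' = 0"
    using e'(1) e'(2)[OF span_base, of "snd w"] e'(2)[OF span_base, of "snd w'"]
    by (auto simp: e_def orthogonal_def dot_square_norm power2_eq_square)
  \<comment> \<open>A quarter of the discriminant of the quadratic equation for \<open>t\<close>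
    which says that \<open>\<zeta> + t *\<^sub>R e\<close> is a unit vector.\<close>
  define D where "D = (\<zeta> \<bullet> e)\<^sup>2 + 1 - \<zeta> \<bullet> \<zeta>"
  have "\<zeta> \<bullet> \<zeta> \<le> 1"
    using zeta(1) by (simp add: dot_square_norm abs_square_le_1)
  then have "0 \<le> D"
    unfolding D_def using zero_le_power2[of "\<zeta> \<bullet> e"] by linarith
  define t where "t = sqrt D - \<zeta> \<bullet> e"
  define z where "z = \<zeta> + t *\<^sub>R e"
  have "z \<bullet> z = \<zeta> \<bullet> \<zeta> + 2 * t * (\<zeta> \<bullet> e) + t\<^sup>2"
    using e(1) by (simp add: z_def inner_add inner_commute[of e \<zeta>] power2_eq_square algebra_simps)
  also have "\<dots> = \<zeta> \<bullet> \<zeta> + (sqrt D)\<^sup>2 - (\<zeta> \<bullet> e)\<^sup>2"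
    by (simp add: t_def power2_eq_square algebra_simps)
  also have "\<dots> = 1"
    using \<open>0 \<le> D\<close> by (simp add: D_def)
  finally have "norm z = 1" by (simp add: norm_eq_1)
  moreover have "z \<bullet> snd w = fst w" "z \<bullet> snd w' = fst w'"
    using zeta e by (simp_all add: z_def inner_add_left)
  ultimately have "z \<in> visible_cap w \<inter> visible_cap w'"
    by (simp add: visible_cap_def)
  then show ?thesis by blast
qed

section \<open>Hyperplanes with the ball on one side\<close>

lemma scribing_ball_eq:
  "(scribing_ball :: (real \<times> (real ^ 'd)) set) = {x \<in> sphere 0 1. norm (snd x) \<le> fst x}"
proof -
  have "norm y \<le> s \<longleftrightarrow> 0 \<le> s \<and> - s\<^sup>2 + (\<Sum>i\<in>UNIV. (y $ i)\<^sup>2) \<le> 0" for s and y :: "real ^ 'd"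
    by (simp add: norm_le_square dot_square_norm[symmetric] inner_vec_def power2_eq_square)
  then show ?thesis
    by (auto simp: scribing_ball_def)
qed

text \<open>The light cone is self-dual. It suffices to test \<open>a\<close> on the rays through
  \<open>(1, z)\<close>, the extreme case being \<open>z\<close> parallel to
  \<open>snd a\<close>.\<close>

lemma scribing_ball_normal:
  fixes a :: "real \<times> (real ^ 'd)"
  assumes "a \<noteq> 0" "scribing_ball \<subseteq> {x. a \<bullet> x \<le> 0}"
  shows "norm (snd a) \<le> - fst a" "fst a < 0"
proof -
  have le: "fst a + snd a \<bullet> z \<le> 0" if "norm z = 1" for z
  proof -
    define w where "w = (1 :: real, z)"
    have nz: "w \<noteq> 0" by (simp add: w_def zero_prod_def)
    have "norm (w /\<^sub>R norm w) = 1"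
      using nz by simp
    then have "w /\<^sub>R norm w \<in> scribing_ball"
      using that by (simp add: scribing_ball_eq w_def)
    then have "a \<bullet> (w /\<^sub>R norm w) \<le> 0"
      using assms(2) by blast
    then have "a \<bullet> w \<le> 0"
      using nz by (simp add: inverse_eq_divide divide_le_0_iff)
    then show ?thesis
      by (simp add: inner_prod_def w_def)
  qed
  show "norm (snd a) \<le> - fst a"
  proof (cases "snd a = 0")
    case True
    obtain z :: "real ^ 'd" where "z \<in> Basis" using nonempty_Basis by blast
    then show ?thesis using le[of z] True by simp
  next
    case False
    then show ?thesis
      using le[of "snd a /\<^sub>R norm (snd a)"]
      by (simp add: dot_square_norm power2_eq_square inverse_eq_divide)
  qed
  then have "fst a = 0 \<Longrightarrow> a = 0" "fst a \<le> 0"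
    using norm_ge_zero[of "snd a"] by (auto simp: prod_eq_iff simp del: norm_ge_zero)
  then show "fst a < 0"
    using assms(1) by (auto simp: less_le)
qed

lemma scribing_ball_tangent:
  assumes "x \<in> scribing_ball" "norm z = 1"
  shows "(-1, z) \<bullet> x \<le> 0"
proof -
  have "z \<bullet> snd x \<le> norm (snd x)"
    using norm_cauchy_schwarz[of z "snd x"] assms(2) by simp
  then show ?thesis
    using assms(1) by (auto simp: scribing_ball_eq inner_prod_def)
qed

text \<open>By the equality case of the Cauchy--Schwarz inequality, both normals are determined by \<open>w\<close> up to
  a positive factor.\<close>

lemma light_cone_normal_unique:
  fixes a b w :: "real \<times> 'b::real_inner"
  assumes a: "fst a < 0" "norm (snd a) \<le> - fst a" and b: "fst b < 0" "norm (snd b) \<le> - fst b"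
    and w: "a \<bullet> w = 0" "b \<bullet> w = 0" "w \<noteq> 0" "norm (snd w) \<le> \<bar>fst w\<bar>"
    and u: "b \<bullet> u = 0"
  shows "a \<bullet> u = 0"
proof -
  have key: "snd c = (- fst c * fst w / (snd w \<bullet> snd w)) *\<^sub>R snd w"
    if c: "fst c < 0" "norm (snd c) \<le> - fst c" "c \<bullet> w = 0" for c
  proof -
    define \<zeta> where "\<zeta> = snd c /\<^sub>R (- fst c)"
    have zeta: "norm \<zeta> \<le> 1" "\<zeta> \<bullet> snd w = fst w"
      using c by (auto simp: \<zeta>_def inner_prod_def field_simps)
    have w0: "snd w \<noteq> 0"
      using zeta(2) w(3) by (auto simp: prod_eq_iff)
    \<comment> \<open>\<open>k *\<^sub>R snd w\<close> is the foot of the perpendicular from 0 to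
      the hyperplane on which \<open>\<zeta>\<close> lies. Its norm is at least 1 by
      \<open>w(4)\<close>, so no other point of that hyperplane can be in the unit ball.\<close>
    define k where "k = fst w / (snd w \<bullet> snd w)"
    have kw: "k * (snd w \<bullet> snd w) = fst w" using w0 by (simp add: k_def)
    have "(norm (snd w))\<^sup>2 \<le> (fst w)\<^sup>2"
      using w(4) by (simp add: abs_le_square_iff[symmetric])
    then have "snd w \<bullet> snd w \<le> fst w * fst w"
      by (simp add: dot_square_norm power2_eq_square)
    then have "1 \<le> k * fst w"
      using w0 by (simp add: k_def field_simps)
    moreover have "\<zeta> \<bullet> \<zeta> \<le> 1"
      using zeta(1) by (simp add: dot_square_norm abs_square_le_1)
    moreover have "(\<zeta> - k *\<^sub>R snd w) \<bullet> (\<zeta> - k *\<^sub>R snd w) = \<zeta> \<bullet> \<zeta> - 2 * k * fst w + k * (k * (snd w \<bullet> snd w))"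
      using zeta(2) by (simp add: inner_diff inner_commute[of "snd w" \<zeta>] algebra_simps)
    ultimately have "(\<zeta> - k *\<^sub>R snd w) \<bullet> (\<zeta> - k *\<^sub>R snd w) \<le> 0"
      unfolding kw by linarith
    then have "\<zeta> = k *\<^sub>R snd w"
      by (metis antisym inner_eq_zero_iff inner_ge_zero right_minus_eq)
    moreover have "snd c = (- fst c) *\<^sub>R \<zeta>"
      using c(1) by (simp add: \<zeta>_def)
    ultimately show ?thesis by (simp add: k_def)
  qed
  define k where "k = fst w / (snd w \<bullet> snd w)"
  have sa: "snd a = (- fst a * k) *\<^sub>R snd w" and sb: "snd b = (- fst b * k) *\<^sub>R snd w"
    using key[OF a w(1)] key[OF b w(2)] by (simp_all add: k_def)
  have "fst b * (fst u - k * (snd w \<bullet> snd u)) = 0"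
    using u by (simp add: inner_prod_def sb algebra_simps)
  then have "fst u = k * (snd w \<bullet> snd u)"
    using b(1) by simp
  then show ?thesis
    by (simp add: inner_prod_def sa algebra_simps)
qed

lemma cone_over_Int_sphere:
  assumes "spherical_polytope P"
  shows "cone_over P \<inter> sphere 0 1 = P"
proof -
  obtain A where P: "P = {x \<in> sphere 0 1. \<forall>a\<in>A. a \<bullet> x \<le> 0}"
    using assms unfolding spherical_polytope_def by blast
  show ?thesis
    unfolding cone_over_halfspaces[OF P] by (subst P) auto
qed

section \<open>Faces of the realization spanned by blocks\<close>

context cyclic_configuration
begin

text \<open>The functional from \<open>support\<close> cuts out a face generated by the
  \<open>k + 1\<close> vectors on it; these are at most \<open>2 * m\<close>, hence independent,
  which gives the dimension. It serves for edges, \<open>k = 1\<close>, and for facets,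
  \<open>k = 2 * m - 1\<close>.\<close>

lemma realized_face:
  assumes cone: "cone_over P = nonneg_span n v" and norm: "\<And>i. i < n \<Longrightarrow> norm (v i) = 1"
    and K: "K \<subseteq> cyclic_blocks n" "card K \<le> m" "card (\<Union>K) = Suc k" "k < 2 * m"
  obtains F where "sph_k_face k F P" "\<And>i. i < n \<Longrightarrow> v i \<in> F \<longleftrightarrow> i \<in> \<Union>K"
    "\<And>y. y \<in> cone_over F \<Longrightarrow> \<exists>c. (\<forall>i\<in>\<Union>K. 0 \<le> c i) \<and> y = (\<Sum>i\<in>\<Union>K. c i *\<^sub>R v i)"
proof -
  define I where "I = \<Union>K"
  have I: "I \<subseteq> {..<n}" "finite I" "card I \<le> 2 * m + 1" "card I = Suc k"
    using Union_cyclic_blocks_subset[OF K(1)] K by (auto simp: I_def intro: finite_subset[OF _ finite_lessThan])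
  obtain g where g: "\<forall>i<n. if i \<in> I then g \<bullet> v i = 0 else g \<bullet> v i < 0"
    using support[OF K(1,2)] unfolding I_def by blast
  have g_le: "g \<bullet> v i \<le> 0" if "i < n" for i
    using g that by (cases "i \<in> I") (auto simp: less_imp_le)
  let ?S = "nonneg_span n v"
  define G where "G = ?S \<inter> {y. g \<bullet> y = 0}"
  have gS: "g \<bullet> y \<le> 0" if y: "y \<in> ?S" for y
  proof -
    obtain c where c: "y = (\<Sum>i<n. c i *\<^sub>R v i)" "\<forall>i<n. 0 \<le> c i"
      using y by (auto simp: nonneg_span_def)
    show ?thesis
      unfolding c(1) inner_sum_right
      using c(2) g_le by (intro sum_nonpos) (auto intro: mult_nonneg_nonpos)
  qed
  have face: "G face_of ?S"
    unfolding G_def by (rule face_of_Int_supporting_hyperplane_le[OF convex_nonneg_span gS])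
  have comb: "\<exists>c. (\<forall>i\<in>I. 0 \<le> c i) \<and> y = (\<Sum>i\<in>I. c i *\<^sub>R v i)" if y: "y \<in> G" for y
  proof -
    obtain c where c: "y = (\<Sum>i<n. c i *\<^sub>R v i)" "\<forall>i<n. 0 \<le> c i"
      using y by (auto simp: G_def nonneg_span_def)
    have "(\<Sum>i<n. - (c i * (g \<bullet> v i))) = 0"
      using y unfolding G_def c(1) by (simp add: inner_sum_right sum_negf)
    then have "\<forall>i\<in>{..<n}. - (c i * (g \<bullet> v i)) = 0"
      using c(2) g_le by (subst (asm) sum_nonneg_eq_0_iff) (auto intro: mult_nonneg_nonpos)
    then have c0: "c i = 0" if "i < n" "i \<notin> I" for i
      using g that by fastforce
    have "y = (\<Sum>i\<in>I. c i *\<^sub>R v i)"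
      unfolding c(1) using I(1) c0 by (intro sum.mono_neutral_right) auto
    then show ?thesis
      using c(2) I(1) by (intro exI[of _ c]) auto
  qed
  have vG: "v i \<in> G \<longleftrightarrow> i \<in> I" if "i < n" for i
    using g[rule_format, OF that] nonneg_span_base[OF that, of v] by (cases "i \<in> I") (auto simp: G_def)
  have "v ` I \<subseteq> G"
    using vG I(1) by auto
  moreover have "G \<subseteq> span (v ` I)"
  proof
    fix y assume "y \<in> G"
    then obtain c where "y = (\<Sum>i\<in>I. c i *\<^sub>R v i)" using comb by blast
    then show "y \<in> span (v ` I)"
      by (auto intro!: span_sum span_scale intro: span_base)
  qed
  ultimately have "card (v ` I) = dim G"
    using basis_card_eq_dim[of "v ` I" G] inj_and_independent[OF I(1,3)] by simp
  then have "dim G = Suc k"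
    using inj_and_independent[OF I(1,3)] I(4) by (simp add: card_image)
  moreover have "0 \<in> G"
    by (simp add: G_def nonneg_span_0)
  ultimately have dimG: "aff_dim G = int k + 1"
    by (simp add: aff_dim_zero hull_inc)
  have scaleG: "a *\<^sub>R y \<in> G" if "y \<in> G" "0 \<le> a" for a y
    using that nonneg_span_scaleR by (auto simp: G_def)
  show ?thesis
  proof (rule that)
    show "sph_k_face k (G \<inter> sphere 0 1) P"
      unfolding sph_k_face_def cone using face dimG by blast
    show "v i \<in> G \<inter> sphere 0 1 \<longleftrightarrow> i \<in> \<Union>K" if "i < n" for i
      using vG[OF that] norm[OF that] by (simp add: I_def)
    have "cone_over (G \<inter> sphere 0 1) \<subseteq> G"
      using \<open>0 \<in> G\<close> scaleG by (auto simp: cone_over_def cone_hull_expl)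
    then show "\<exists>c. (\<forall>i\<in>\<Union>K. 0 \<le> c i) \<and> y = (\<Sum>i\<in>\<Union>K. c i *\<^sub>R v i)" if "y \<in> cone_over (G \<inter> sphere 0 1)" for y
      using comb that unfolding I_def by blast
  qed
qed

end

section \<open>Counting caps with the separator theorem\<close>

lemma separator_bound:
  fixes c :: real
  assumes M: "1 \<le> M" and n: "0 < n" and k: "0 < k"
    and le: "real n / (real M + 2) \<le> c * real k powr (1 / real M) * real n powr (1 - 1 / real M)"
  shows "real n \<le> (c * (real M + 2)) ^ M * real k"
proof -
  have root: "(x powr (1 / real M)) ^ M = x" if "0 < x" for x :: real
    using that M by (simp add: powr_realpow[symmetric] powr_powr)
  have split: "real n = real n powr (1 - 1 / real M) * real n powr (1 / real M)"
    using n by (simp add: powr_add[symmetric])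
  have "real n powr (1 - 1 / real M) * real n powr (1 / real M) \<le>
      real n powr (1 - 1 / real M) * (c * (real M + 2) * real k powr (1 / real M))"
    using le unfolding split[symmetric] by (simp add: field_simps)
  then have "real n powr (1 / real M) \<le> c * (real M + 2) * real k powr (1 / real M)"
    using n by simp
  then have "(real n powr (1 / real M)) ^ M \<le> (c * (real M + 2) * real k powr (1 / real M)) ^ M"
    by (rule power_mono) simp
  then show ?thesis
    using n k by (simp add: root power_mult_distrib)
qed

text \<open>Two nonempty parts would contain adjacent caps, so one part is empty and the other
  misses at least the fraction \<open>1 / (M + 2)\<close> of the caps, which the separator has to
  contain. As \<open>M = DIM('a) - 1\<close>, this is the source of the factor
  \<open>DIM('a) + 1\<close>.\<close>

lemma complete_intersection_graph_bound:
  fixes \<C> :: "'a::euclidean_space set set"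
  assumes c: "sphere_separator_constant TYPE('a) c" and ply: "ply_system k \<C>"
    and adj: "\<And>C D. C \<in> \<C> \<Longrightarrow> D \<in> \<C> \<Longrightarrow> C \<inter> D \<noteq> {}"
    and dim: "2 \<le> DIM('a)" and pos: "0 < k" "0 < card \<C>"
  shows "real (card \<C>) \<le> (c * (real DIM('a) + 1)) ^ (DIM('a) - 1) * real k"
proof -
  define M where "M = DIM('a) - 1"
  obtain X A B where XAB: "X \<union> A \<union> B = \<C>" "X \<inter> A = {}" "X \<inter> B = {}" "A \<inter> B = {}"
      and nonadj: "\<forall>C\<in>A. \<forall>D\<in>B. \<not> cap_adjacent C D"
      and A: "real (card A) \<le> (real M + 1) / (real M + 2) * real (card \<C>)"
      and B: "real (card B) \<le> (real M + 1) / (real M + 2) * real (card \<C>)"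
      and X: "real (card X) \<le> c * real k powr (1 / real M) * real (card \<C>) powr (1 - 1 / real M)"
    using c[unfolded sphere_separator_constant_def Let_def, folded M_def, rule_format, OF ply]
    by (elim exE conjE) (rule that; assumption)
  have fin: "finite X" "finite A" "finite B"
    using ply XAB(1) by (auto simp: ply_system_def)
  have "A = {} \<or> B = {}"
  proof (rule ccontr)
    assume "\<not> ?thesis"
    then obtain C D where CD: "C \<in> A" "D \<in> B" by blast
    then have "C \<noteq> D" "C \<inter> D \<noteq> {}"
      using XAB(1,4) by (blast, intro adj) blast+
    then show False
      using nonadj CD unfolding cap_adjacent_def by blast
  qed
  then have "card \<C> = card X + card A \<or> card \<C> = card X + card B"
    using XAB fin card_Un_disjoint[of X A] card_Un_disjoint[of X B] by auto
  then have "real (card \<C>) - (real M + 1) / (real M + 2) * real (card \<C>) \<le> real (card X)"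
    using A B by auto
  then have "real (card \<C>) / (real M + 2) \<le> real (card X)"
    by (simp add: field_simps)
  then have "real (card \<C>) \<le> (c * (real M + 2)) ^ M * real k"
    using X pos dim by (intro separator_bound) (auto simp: M_def)
  moreover have "real M + 2 = real DIM('a) + 1"
    using dim by (simp add: M_def of_nat_diff)
  ultimately show ?thesis
    unfolding M_def by (simp only:)
qed

section \<open>Scribed realizations of cyclic polytopes\<close>

proposition realization_of_cyclic_polytope:
  fixes P :: "(real \<times> (real ^ 'd)) set"
  assumes Q: "cyclic_polytope n Q" and real: "realizes P Q" and dim: "CARD('d) = 2 * m" "1 \<le> m"
  obtains v where "cyclic_configuration m n v" "\<And>i. i < n \<Longrightarrow> norm (v i) = 1"
    "cone_over P = nonneg_span n v"
proof -
  obtain f where P: "spherical_polytope P" and bij: "bij_betw f {F. F face_of Q} (sph_faces P)"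
    and iso: "\<And>F G. F face_of Q \<Longrightarrow> G face_of Q \<Longrightarrow> F \<subseteq> G \<longleftrightarrow> f F \<subseteq> f G"
    using real unfolding realizes_def by blast
  obtain x where x: "Q = convex hull (x ` {..<n})"
    and faces: "\<And>K. K \<subseteq> cyclic_blocks n \<Longrightarrow> card K \<le> m \<Longrightarrow>
      \<exists>F. F face_of Q \<and> (\<forall>i<n. x i \<in> F \<longleftrightarrow> i \<in> \<Union>K)"
    and vertex: "\<And>i. i < n \<Longrightarrow> {x i} face_of Q"
    using cyclic_polytope_faces[OF Q dim(1)] by metis
  obtain v where v: "\<And>i. i < n \<Longrightarrow> norm (v i) = 1" "cone_over P = nonneg_span n v"
    and supp: "\<And>F. F face_of Q \<Longrightarrow> \<exists>g. \<forall>i<n. if x i \<in> F then g \<bullet> v i = 0 else g \<bullet> v i < 0"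
    using realization_vectors[OF P x vertex bij iso] by metis
  have "cyclic_configuration m n v"
  proof
    show "DIM(real \<times> (real ^ 'd)) = 2 * m + 1"
      using dim by simp
    show "2 * m + 1 \<le> n"
      using Q dim by (simp add: cyclic_polytope_def)
    fix K assume "K \<subseteq> cyclic_blocks n" "card K \<le> m"
    then obtain F where "F face_of Q" "\<forall>i<n. x i \<in> F \<longleftrightarrow> i \<in> \<Union>K"
      using faces by blast
    then show "\<exists>g. \<forall>i<n. if i \<in> \<Union>K then g \<bullet> v i = 0 else g \<bullet> v i < 0"
      using supp[of F] by simp
  qed (rule dim(2))
  then show ?thesis using that v by blast
qed

theorem proposition6p6:
  fixes d n :: nat and c :: real and Q :: "(real ^ 'd) set"
  assumes "CARD('d) = d" and "4 \<le> d" and "even d"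
    and "sphere_separator_constant TYPE(real ^ 'd) c"
    and "real n > (c * (real d + 1)) ^ (d - 1) * (3 * real d / 2 - 1)"
    and "cyclic_polytope n Q"
  shows "\<not> strongly_scribable 1 (d - 1) Q"
proof
  assume "strongly_scribable 1 (d - 1) Q"
  then obtain P where P: "realizes P Q" "strongly_scribed 1 (d - 1) P"
    by (auto simp: strongly_scribable_def)
  obtain m where d_eq: "d = 2 * m" using \<open>even d\<close> by blast
  then have m2: "2 \<le> m" using \<open>4 \<le> d\<close> by simp
  obtain v where "cyclic_configuration m n v" and norm: "\<And>i. i < n \<Longrightarrow> norm (v i) = 1"
      and cone: "cone_over P = nonneg_span n v"
    using realization_of_cyclic_polytope[of n Q P m] assms(1,6) P(1) d_eq m2 by auto
  interpret cyclic_configuration m n v by fact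
  have "spherical_polytope P" using P(1) by (simp add: realizes_def)
  then have vP: "v i \<in> P" if "i < n" for i
    using cone_over_Int_sphere[of P] nonneg_span_base[OF that, of v] norm[OF that] cone by auto
  \<comment> \<open>Two singleton blocks require \<open>2 \<le> m\<close>, which
    \<open>4 \<le> d\<close> provides. The hyperplane meets \<open>P\<close> just in the edge, so
    its normal vanishes at no third vertex.\<close>
  have edge: "\<exists>a. fst a < 0 \<and> norm (snd a) \<le> - fst a \<and> (\<forall>k<n. a \<bullet> v k = 0 \<longleftrightarrow> k = i \<or> k = j)"
    if ij: "i < n" "j < n" "i \<noteq> j" for i j
  proof -
    define K where "K = {{i}, {j}}"
    have UK: "\<Union>K = {i, j}" by (auto simp: K_def)
    have K: "K \<subseteq> cyclic_blocks n" "card K \<le> m" "card (\<Union>K) = Suc 1" "1 < 2 * m"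
      using ij m2 by (auto simp: UK) (auto simp: K_def cyclic_blocks_def)
    obtain F where F: "sph_k_face 1 F P" "\<And>k. k < n \<Longrightarrow> v k \<in> F \<longleftrightarrow> k \<in> \<Union>K"
      using realized_face[OF cone norm K] by metis
    obtain a where a: "supporting_normal a P" "F = {x. a \<bullet> x = 0} \<inter> P" "scribing_ball \<subseteq> {x. a \<bullet> x \<le> 0}"
      using F(1) P(2) unfolding strongly_scribed_def strongly_avoids_def by blast
    have "a \<noteq> 0" using a(1) by (simp add: supporting_normal_def)
    moreover have "a \<bullet> v k = 0 \<longleftrightarrow> k = i \<or> k = j" if "k < n" for k
      using F(2)[OF that] vP[OF that] a(2) UK by auto
    ultimately show ?thesis
      using scribing_ball_normal[OF _ a(3)] by blast
  qed
  have n5: "5 \<le> n" using n m2 by linarith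
  \<comment> \<open>Through a point of the light cone or its negative there is at most one
    hyperplane with the ball on one side. The edges from \<open>i\<close> to \<open>j\<close> and to
    \<open>k\<close> would then share a hyperplane, although it contains no third vertex.\<close>
  have outside: "\<bar>fst (v i)\<bar> < norm (snd (v i))" if i: "i < n" for i
  proof (rule ccontr)
    assume "\<not> ?thesis"
    then have light: "norm (snd (v i)) \<le> \<bar>fst (v i)\<bar>" by simp
    obtain j k where jk: "j < n" "k < n" "j \<noteq> i" "k \<noteq> i" "j \<noteq> k"
    proof -
      have "\<exists>j k. j < n \<and> k < n \<and> j \<noteq> i \<and> k \<noteq> i \<and> j \<noteq> k"
        using n5 by presburger
      then show ?thesis using that by blast
    qed
    obtain a where a: "fst a < 0" "norm (snd a) \<le> - fst a" "\<forall>l<n. a \<bullet> v l = 0 \<longleftrightarrow> l = i \<or> l = j"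
      using edge[of i j] i jk by auto
    obtain b where b: "fst b < 0" "norm (snd b) \<le> - fst b" "\<forall>l<n. b \<bullet> v l = 0 \<longleftrightarrow> l = i \<or> l = k"
      using edge[of i k] i jk by auto
    have "v i \<noteq> 0" using norm[OF i] by auto
    then have "a \<bullet> v k = 0"
      using light_cone_normal_unique[OF a(1,2) b(1,2), of "v i" "v k"] a(3) b(3) i jk light by auto
    then show False using a(3) jk by auto
  qed
  define C where "C i = visible_cap (v i)" for i
  have DIM: "DIM(real ^ 'd) = d" using assms(1) by simp
  have inj: "inj_on C {..<n}"
  proof (rule inj_onI, rule ccontr)
    fix i j assume ij: "i \<in> {..<n}" "j \<in> {..<n}" "C i = C j" "i \<noteq> j"
    then have "v i = v j"
      using visible_cap_eqD[OF outside outside, of i j] norm DIM \<open>4 \<le> d\<close> by (simp add: C_def)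
    moreover have "inj_on v {i, j}"
      using ij m2 by (intro inj_and_independent) auto
    ultimately show False using ij by auto
  qed
  \<comment> \<open>The case \<open>i = j\<close> says that a cap is nonempty; an edge to an
    auxiliary vertex \<open>l\<close> serves for it.\<close>
  have meet: "C i \<inter> C j \<noteq> {}" if "i < n" "j < n" for i j
  proof -
    have "\<exists>l<n. l \<noteq> i \<and> (i = j \<or> l = j)"
      using \<open>i < n\<close> \<open>j < n\<close> n5 by presburger
    then obtain l where l: "l < n" "l \<noteq> i" "i = j \<or> l = j"
      by blast
    then obtain a where "fst a < 0" "norm (snd a) \<le> - fst a" "\<forall>k<n. a \<bullet> v k = 0 \<longleftrightarrow> k = i \<or> k = l"
      using edge[of i l] \<open>i < n\<close> by auto
    then show ?thesis
      unfolding C_def using that l DIM \<open>4 \<le> d\<close> by (intro visible_caps_meet[of a]) auto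
  qed
  have ply: "ply_system (3 * m - 1) (C ` {..<n})"
    unfolding ply_system_def
  proof (intro conjI ballI notI)
    fix D assume "D \<in> C ` {..<n}"
    then obtain i where "i < n" "D = C i" by auto
    then show "spherical_cap D"
      using spherical_cap_visible_cap[OF outside] by (simp add: C_def)
  next
    assume "\<exists>z\<in>sphere 0 1. 3 * m - 1 \<le>
      card {D \<in> C ` {..<n}. z \<in> top_of_set (sphere 0 1) interior_of D}"
    then obtain z where z: "norm z = 1"
        "3 * m - 1 \<le> card {D \<in> C ` {..<n}. z \<in> top_of_set (sphere 0 1) interior_of D}"
      by auto
    \<comment> \<open>The normal of the tangent hyperplane at \<open>z\<close>: the ball is on its
      nonpositive side, the vertices whose caps have \<open>z\<close> in the interior are on its
      positive side.\<close>
    define l where "l = (-1 :: real, z)"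
    have l: "l \<bullet> y = z \<bullet> snd y - fst y" for y
      by (simp add: l_def inner_prod_def)
    have "{D \<in> C ` {..<n}. z \<in> top_of_set (sphere 0 1) interior_of D} \<subseteq> C ` {i. i < n \<and> 0 < l \<bullet> v i}"
      using visible_cap_interior[OF outside] by (auto simp: C_def l)
    then have "card {D \<in> C ` {..<n}. z \<in> top_of_set (sphere 0 1) interior_of D} \<le>
        card {i. i < n \<and> 0 < l \<bullet> v i}"
      by (intro order.trans[OF card_mono card_image_le]) auto
    then obtain K where K: "K \<subseteq> cyclic_blocks n" "card K \<le> m" "\<forall>i\<in>\<Union>K. 0 < l \<bullet> v i"
        "card (\<Union>K) = 2 * m"
      using halfspace_contains_facet[of l] z(2) by auto
    have K': "card (\<Union>K) = Suc (d - 1)" "d - 1 < 2 * m"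
      using K(4) d_eq m2 by auto
    obtain F where F: "sph_k_face (d - 1) F P"
        "\<And>y. y \<in> cone_over F \<Longrightarrow> \<exists>c. (\<forall>i\<in>\<Union>K. 0 \<le> c i) \<and> y = (\<Sum>i\<in>\<Union>K. c i *\<^sub>R v i)"
      using realized_face[OF cone norm K(1,2) K'] by metis
    have "strongly_cuts F"
      using P(2) F(1) by (simp add: strongly_scribed_def)
    then obtain y where y: "y \<in> cone_over F" "norm y = 1" "y \<in> scribing_ball"
      using rel_interior_subset by (fastforce simp: strongly_cuts_def sph_rel_interior_def)
    obtain b where b: "\<forall>i\<in>\<Union>K. 0 \<le> b i" "y = (\<Sum>i\<in>\<Union>K. b i *\<^sub>R v i)"
      using F(2)[OF y(1)] by blast
    have fin: "finite (\<Union>K)"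
      using K(4) m2 by (metis card.infinite mult_is_0 not_numeral_le_zero zero_neq_numeral)
    \<comment> \<open>A point of the facet in the ball has \<open>l \<bullet> y \<le> 0\<close>, but
      it is a nonnegative combination of vectors on which \<open>l\<close> is positive. This leaves
      only \<open>y = 0\<close>, which is not on the sphere.\<close>
    have "(\<Sum>i\<in>\<Union>K. b i * (l \<bullet> v i)) \<le> 0"
      using scribing_ball_tangent[OF y(3) z(1)] unfolding l_def[symmetric] b(2) by (simp add: inner_sum_right)
    moreover have nonneg: "0 \<le> b i * (l \<bullet> v i)" if "i \<in> \<Union>K" for i
      using bspec[OF b(1) that] bspec[OF K(3) that] by simp
    ultimately have "(\<Sum>i\<in>\<Union>K. b i * (l \<bullet> v i)) = 0"
      by (intro antisym sum_nonneg) auto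
    then have "\<forall>i\<in>\<Union>K. b i * (l \<bullet> v i) = 0"
      using fin nonneg by (subst (asm) sum_nonneg_eq_0_iff) auto
    moreover have "l \<bullet> v i \<noteq> 0" if "i \<in> \<Union>K" for i
      using bspec[OF K(3) that] by simp
    ultimately have "\<forall>i\<in>\<Union>K. b i = 0"
      by (meson mult_eq_0_iff)
    then have "y = 0" unfolding b(2) by (intro sum.neutral) auto
    then show False using y(2) by simp
  qed simp
  have card: "card (C ` {..<n}) = n"
    using inj by (simp add: card_image)
  have "real n \<le> (c * (real d + 1)) ^ (d - 1) * real (3 * m - 1)"
    using complete_intersection_graph_bound[OF assms(4) ply] meet card DIM m2 n5 \<open>4 \<le> d\<close> by auto
  also have "real (3 * m - 1) = 3 * real d / 2 - 1"
    using d_eq m2 by (simp add: of_nat_diff)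
  finally show False using assms(5) by linarith
qed

end
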